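(* Let $\mathfrak g$ be of type $A_{n-1}^{(1)}$ and let $L$ be the multiplicity array of a single Kirillov--Reshetikhin crystal $B=B^{r,s}$ ($1\le r\le n-1$, $s\ge1$), i.e. $L_s^{(r)}=1$ and all other $L_i^{(a)}=0$. Then the map $\mathrm{pr}:\mathrm{RC}(L)\to\mathrm{RC}(L)$ defined by the two-step algorithm in the context is the promotion operator on rigged configurations: under the isomorphism of classical crystals $\Psi:B^{r,s}\to\mathrm{RC}(L)$, it corresponds to the promotion operator $\mathrm{pr}_B$ of $B^{r,s}$, i.e. $\mathrm{pr}\circ\Psi=\Psi\circ\mathrm{pr}_B$.
   Context: Setting: $\overline I=\{1,\ldots,n-1\}$, $I=\overline I\cup\{0\}=\mathbb Z/n$; simple roots $\alpha_a$, fundamental weights $\Lambda_a$ and Cartan matrix $A_{ab}=(\alpha_a|\alpha_b)$ ($a,b\in\overline I$) are those of finite type $A_{n-1}$. Put $\mathcal H=\overline I\times\mathbb Z_{>0}$. A multiplicity array is $L=(L_i^{(a)}\mid(a,i)\in\mathcal H)$ with nonnegative integer entries, finitely many nonzero. Weights are written as $\lambda=(\lambda_1,\ldots,\lambda_n)\in\mathbb Z^n$ with $\Lambda_a=(1^a,0^{n-a})$, $\alpha_a=\epsilon_a-\epsilon_{a+1}$ ($\epsilon_a$ the standard basis), $\langle h_a,\lambda\rangle=\lambda_a-\lambda_{a+1}$ for $a\in\overline I$, and $\langle h_0,\lambda\rangle=\lambda_n-\lambda_1$. Configurations: for a weight $\Lambda$, an $(L,\Lambda)$-configuration is a sequence of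 partitions $\nu=(\nu^{(a)})_{a\in\overline I}$ with $\sum_{(a,i)\in\mathcal H} i\,m_i^{(a)}\alpha_a=\sum_{(a,i)\in\mathcal H} i\,L_i^{(a)}\Lambda_a-\Lambda$, where $m_i^{(a)}$ is the number of parts of length $i$ in $\nu^{(a)}$. Vacancy numbers: $p_i^{(a)}=\sum_{j\ge1}\min(i,j)L_j^{(a)}-\sum_{(b,j)\in\mathcal H}(\alpha_a|\alpha_b)\min(i,j)m_j^{(b)}$. A configuration is admissible if all $p_i^{(a)}\ge0$. Riggings: a rigging $J$ of $\nu$ assigns to each part of each $\nu^{(a)}$ an integer label, up to permuting labels among equal parts of the same $\nu^{(a)}$. So $(\nu,J)$ amounts to, for each $a$, a finite multiset $(\nu,J)^{(a)}$ of strings $(i,x)$ ($i$ = length, $x$ = label). The colabel of $(i,x)$ in $(\nu,J)^{(a)}$ is $p_i^{(a)}-x$; the string is singular if $x=p_i^{(a)}$. For dominant $\Lambda$, $\overline{\mathrm{RC}}(L,\Lambda)$ is the set of $(\nu,J)$ with $\nu$ an admissible $(L,\Lambda)$-configuration and $0\le x\le p_i^{(a)}$ for every string $(i,x)$ in $(\nu,J)^{(a)}$; $\overline{\mathrm{RC}}(L)$ is the union over all dominant $\Lambda$. Operators, for $a\in\overline I$: (1) $e_a(\nu,J)$: undefined if $(\nu,J)^{(a)}$ has no string with negative label. Otherwise select, among strings of $(\nu,J)^{(a)}$ with the smallest (negative) label, one of smallest length; remove a box from it, increase its label by one (a string of length $1$, whose label is then $-1$, is deleted), and change the labels of all other strings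 so that their colabels are unchanged. (2) $f_a(\nu,J)$: select, among strings of $(\nu,J)^{(a)}$ with the smallest nonpositive label, one of largest length; add a box to it, decrease its label by one, and change the labels of all other strings so that their colabels are unchanged. If there is no string with nonpositive label, instead add a new string of length $1$ with label $-1$ (keeping all other colabels fixed). If the result is not valid, i.e. some label exceeds the corresponding vacancy number, $f_a(\nu,J)$ is undefined. $\mathrm{RC}(L)$ is the set generated from $\overline{\mathrm{RC}}(L)$ by the operators $e_a,f_a$, $a\in\overline I$. The weight is $\mathrm{wt}(\nu,J)=\sum_{(a,i)\in\mathcal H}i(L_i^{(a)}\Lambda_a-m_i^{(a)}\alpha_a)$, and $\mathrm{RC}(L,\lambda)$ is the set of elements of $\mathrm{RC}(L)$ of weight $\lambda$. With these operators and weights $\mathrm{RC}(L)$ is a classical ($\overline I$-)crystal; for $L$ the multiplicity array of $B^{r,s}$ it is isomorphic to $B(s\Lambda_r)$, hence there is a unique isomorphism $\Psi:B^{r,s}\to\mathrm{RC}(L)$ of classical crystals. Promotion operator of $B=B^{r,s}$: the bijection $\mathrm{pr}_B:B\to B$ with $\mathrm{pr}_B\circ f_a=f_{a+1}\circ\mathrm{pr}_B$ for all $a\in I$ (subscripts modulo $n$; both sides undefined simultaneously) and $\langle h_{a+1},\mathrm{wt}(\mathrm{pr}_B(b))\rangle=\langle h_a,\mathrm{wt}(b)\rangle$ for all $b\in B$, $a\in I$. The affine operators of $B^{r,s}$ are $e_0=\mathrm{pr}_B^{-1}\circ e_1\circ\mathrm{pr}_B$ and $f_0=\mathrm{pr}_B^{-1}\circ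 f_1\circ\mathrm{pr}_B$. The map $\mathrm{pr}$ on rigged configurations: let $(\nu,J)\in\mathrm{RC}(L,\lambda)$, $\lambda=(\lambda_1,\ldots,\lambda_n)$. Then $\mathrm{pr}(\nu,J)$ is obtained as follows. Step 1: regard $(\nu,J)$ as a rigged configuration of type $A_n$ with an additional empty $n$-th rigged partition $(\nu,J)^{(n)}=\emptyset$ (and $L_i^{(n)}=0$ for all $i$), and set $(\nu',J')=f_1^{\lambda_1}f_2^{\lambda_2}\cdots f_n^{\lambda_n}(\nu,J)$. Step 2: apply the following algorithm $\rho$ to $(\nu',J')$ $\lambda_n$ times. Find the smallest singular string in the $n$-th rigged partition; let its length be $\ell^{(n)}$. Then for $k=n-1,n-2,\ldots,1$ successively find the smallest singular string in the $k$-th rigged partition of length $\ell^{(k)}\ge\ell^{(k+1)}$. Shorten the selected strings by one and make them singular again (with respect to the new vacancy numbers), leaving the labels of all unselected strings unchanged. The result has empty $n$-th rigged partition and is regarded again as of type $A_{n-1}$. *)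

theory Defs
  imports "HOL-Library.Multiset"
begin

text \<open>Throughout, \<open>n\<close> refers to type \<open>A\<close> of rank \<open>n - 1\<close>, with nodes \<open>{1..<n}\<close>; weights in
  \<open>\<int>\<^sup>n\<close> are functions \<open>nat \<Rightarrow> int\<close> vanishing outside \<open>{1..n}\<close>.\<close>

type_synonym weight = "nat \<Rightarrow> int"

definition fund_weight :: "nat \<Rightarrow> weight" where
  "fund_weight a = (\<lambda>c. if 1 \<le> c \<and> c \<le> a then 1 else 0)"

definition simple_root :: "nat \<Rightarrow> weight" where
  "simple_root a = (\<lambda>c. if c = a then 1 else if c = a + 1 then -1 else 0)"

definition cartan :: "nat \<Rightarrow> nat \<Rightarrow> int" where
  "cartan a b = (if a = b then 2 else if a = b + 1 \<or> b = a + 1 then -1 else 0)"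

text \<open>The pairing of a weight with the simple coroot \<open>h\<^sub>a\<close>, where \<open>a \<in> {0..<n}\<close> represents
  a class modulo \<open>n\<close>.\<close>

definition coroot_pairing :: "nat \<Rightarrow> nat \<Rightarrow> weight \<Rightarrow> int" where
  "coroot_pairing n a v = (if a = 0 then v n - v 1 else v a - v (a + 1))"

definition dominant :: "nat \<Rightarrow> weight \<Rightarrow> bool" where
  "dominant n v \<longleftrightarrow> (\<forall>a\<in>{1..<n}. 0 \<le> coroot_pairing n a v)"

record 'b crystal =
  elems :: "'b set"
  cwt :: "'b \<Rightarrow> weight"
  e_op :: "nat \<Rightarrow> 'b \<Rightarrow> 'b option"
  f_op :: "nat \<Rightarrow> 'b \<Rightarrow> 'b option"

definition classical_crystal_iso ::
    "nat \<Rightarrow> 'b crystal \<Rightarrow> 'c crystal \<Rightarrow> ('b \<Rightarrow> 'c) \<Rightarrow> bool" where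
  "classical_crystal_iso n B C \<Psi> \<longleftrightarrow>
     bij_betw \<Psi> (elems B) (elems C) \<and>
     (\<forall>b\<in>elems B. cwt C (\<Psi> b) = cwt B b \<and>
        (\<forall>a\<in>{1..<n}. e_op C a (\<Psi> b) = map_option \<Psi> (e_op B a b) \<and>
                      f_op C a (\<Psi> b) = map_option \<Psi> (f_op B a b)))"

text \<open>The operators \<open>f\<^sub>a\<close>, \<open>a \<in> {0..<n}\<close>, where \<open>f\<^sub>0 = p\<^sup>-\<^sup>1 \<circ> f\<^sub>1 \<circ> p\<close> for a bijection \<open>p\<close> of the
  crystal: the affine operator is the one induced by the promotion operator itself.\<close>

definition affine_f :: "'b crystal \<Rightarrow> ('b \<Rightarrow> 'b) \<Rightarrow> nat \<Rightarrow> 'b \<Rightarrow> 'b option" where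
  "affine_f B p a b =
     (if a = 0 then map_option (inv_into (elems B) p) (f_op B 1 (p b)) else f_op B a b)"

definition promotion_operator :: "nat \<Rightarrow> 'b crystal \<Rightarrow> ('b \<Rightarrow> 'b) \<Rightarrow> bool" where
  "promotion_operator n B p \<longleftrightarrow>
     bij_betw p (elems B) (elems B) \<and>
     (\<forall>b\<in>elems B. \<forall>a\<in>{0..<n}.
        map_option p (affine_f B p a b) = affine_f B p ((a + 1) mod n) (p b) \<and>
        coroot_pairing n ((a + 1) mod n) (cwt B (p b)) = coroot_pairing n a (cwt B b))"

text \<open>As a classical crystal, \<open>B\<^sup>r\<^sup>,\<^sup>s = B(s \<Lambda>\<^sub>r)\<close> is realized by the semistandard tableaux of
  rectangular shape with \<open>r\<close> rows and \<open>s\<close> columns (a tableau is the list of its rows, English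
  notation), with Kashiwara operators given by bracketing the row reading word. A letter
  \<open>a + 1\<close> is an opening and a letter \<open>a\<close> a closing bracket.\<close>

definition rect_tableaux :: "nat \<Rightarrow> nat \<Rightarrow> nat \<Rightarrow> nat list list set" where
  "rect_tableaux n r s =
     {T. length T = r \<and>
         (\<forall>row\<in>set T. length row = s \<and> sorted row \<and> set row \<subseteq> {1..n}) \<and>
         (\<forall>i j. i + 1 < r \<and> j < s \<longrightarrow> T ! i ! j < T ! (i + 1) ! j)}"

definition reading_word :: "nat list list \<Rightarrow> nat list" where
  "reading_word T = concat (rev T)"

inductive bracketed_pair :: "nat \<Rightarrow> nat list \<Rightarrow> nat \<Rightarrow> nat \<Rightarrow> bool" for a w where
  "\<lbrakk>j < k; k < length w; w ! j = a + 1; w ! k = a;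
    \<forall>l. j < l \<and> l < k \<and> w ! l \<in> {a, a + 1} \<longrightarrow>
        (\<exists>m. j < m \<and> m < k \<and> (bracketed_pair a w l m \<or> bracketed_pair a w m l))\<rbrakk>
   \<Longrightarrow> bracketed_pair a w j k"

definition unbracketed :: "nat \<Rightarrow> nat list \<Rightarrow> nat \<Rightarrow> nat set" where
  "unbracketed a w x = {k. k < length w \<and> w ! k = x \<and>
     (\<nexists>l. bracketed_pair a w k l \<or> bracketed_pair a w l k)}"

definition word_e :: "nat \<Rightarrow> nat list \<Rightarrow> nat list option" where
  "word_e a w = (let U = unbracketed a w (a + 1) in
     if U = {} then None else Some (w[Min U := a]))"

definition word_f :: "nat \<Rightarrow> nat list \<Rightarrow> nat list option" where
  "word_f a w = (let U = unbracketed a w a in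
     if U = {} then None else Some (w[Max U := a + 1]))"

definition refill :: "nat list list \<Rightarrow> nat list \<Rightarrow> nat list list" where
  "refill T w = (THE T'. map length T' = map length T \<and> reading_word T' = w)"

definition KR_crystal :: "nat \<Rightarrow> nat \<Rightarrow> nat \<Rightarrow> nat list list crystal" where
  "KR_crystal n r s =
     \<lparr>elems = rect_tableaux n r s,
      cwt = (\<lambda>T c. int (count (mset (reading_word T)) c)),
      e_op = (\<lambda>a T. map_option (refill T) (word_e a (reading_word T))),
      f_op = (\<lambda>a T. map_option (refill T) (word_f a (reading_word T)))\<rparr>"

type_synonym mult_array = "nat \<Rightarrow> nat \<Rightarrow> nat"
type_synonym config = "nat \<Rightarrow> nat multiset"
type_synonym rigged_config = "nat \<Rightarrow> (nat \<times> int) multiset"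

text \<open>\<open>L a i\<close> stands for \<open>L\<^sub>i\<close> at node \<open>a\<close>. A rigged configuration assigns to each node its
  multiset of strings (length, label), and the empty multiset to every \<open>a \<notin> {1..<n}\<close>.\<close>

definition KR_mult :: "nat \<Rightarrow> nat \<Rightarrow> mult_array" where
  "KR_mult r s = (\<lambda>a i. if a = r \<and> i = s then 1 else 0)"

definition shape :: "rigged_config \<Rightarrow> config" where
  "shape R = (\<lambda>a. image_mset fst (R a))"

text \<open>The sums over the infinite index set \<open>H\<close> are restricted to the finite support of the
  respective multiplicities.\<close>

definition H_index :: "nat \<Rightarrow> (nat \<times> nat) set" where
  "H_index n = {1..<n} \<times> {1..}"

definition L_weight :: "nat \<Rightarrow> mult_array \<Rightarrow> weight" where
  "L_weight n L =
     (\<lambda>c. \<Sum>(a, i) | (a, i) \<in> H_index n \<and> L a i \<noteq> 0. int (i * L a i) * fund_weight a c)"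

definition config_weight :: "nat \<Rightarrow> config \<Rightarrow> weight" where
  "config_weight n \<nu> =
     (\<lambda>c. \<Sum>(a, i) | (a, i) \<in> H_index n \<and> count (\<nu> a) i \<noteq> 0.
        int (i * count (\<nu> a) i) * simple_root a c)"

definition is_configuration :: "nat \<Rightarrow> mult_array \<Rightarrow> weight \<Rightarrow> config \<Rightarrow> bool" where
  "is_configuration n L \<Lambda> \<nu> \<longleftrightarrow>
     (\<forall>a. 0 \<notin># \<nu> a) \<and> (\<forall>a. a \<notin> {1..<n} \<longrightarrow> \<nu> a = {#}) \<and>
     config_weight n \<nu> = (\<lambda>c. L_weight n L c - \<Lambda> c)"

definition vacancy :: "nat \<Rightarrow> mult_array \<Rightarrow> config \<Rightarrow> nat \<Rightarrow> nat \<Rightarrow> int" where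
  "vacancy n L \<nu> a i =
     (\<Sum>j | 1 \<le> j \<and> L a j \<noteq> 0. int (min i j * L a j)) -
     (\<Sum>(b, j) | (b, j) \<in> H_index n \<and> count (\<nu> b) j \<noteq> 0.
        cartan a b * int (min i j * count (\<nu> b) j))"

definition admissible :: "nat \<Rightarrow> mult_array \<Rightarrow> config \<Rightarrow> bool" where
  "admissible n L \<nu> \<longleftrightarrow> (\<forall>(a, i)\<in>H_index n. 0 \<le> vacancy n L \<nu> a i)"

definition RC_bar_wt :: "nat \<Rightarrow> mult_array \<Rightarrow> weight \<Rightarrow> rigged_config set" where
  "RC_bar_wt n L \<Lambda> =
     {R. is_configuration n L \<Lambda> (shape R) \<and> admissible n L (shape R) \<and>
         (\<forall>a\<in>{1..<n}. \<forall>(i, x)\<in>#R a. 0 \<le> x \<and> x \<le> vacancy n L (shape R) a i)}"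

definition RC_bar :: "nat \<Rightarrow> mult_array \<Rightarrow> rigged_config set" where
  "RC_bar n L = (\<Union>\<Lambda>\<in>{\<Lambda>. dominant n \<Lambda>}. RC_bar_wt n L \<Lambda>)"

definition RC_weight :: "nat \<Rightarrow> mult_array \<Rightarrow> rigged_config \<Rightarrow> weight" where
  "RC_weight n L R = (\<lambda>c. L_weight n L c - config_weight n (shape R) c)"

text \<open>Strings of length \<open>0\<close> are discarded.\<close>

definition string :: "nat \<Rightarrow> int \<Rightarrow> (nat \<times> int) multiset" where
  "string i x = (if i = 0 then {#} else {#(i, x)#})"

text \<open>Replace the strings \<open>old\<close> at node \<open>a\<close> by \<open>new\<close>; all other strings, at every node, keep
  their colabels.\<close>

definition replace_strings ::
    "nat \<Rightarrow> mult_array \<Rightarrow> nat \<Rightarrow> (nat \<times> int) multiset \<Rightarrow> (nat \<times> int) multiset \<Rightarrow>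
     rigged_config \<Rightarrow> rigged_config" where
  "replace_strings n L a old new R =
     (let rest = R(a := R a - old);
          \<nu> = shape R;
          \<nu>' = shape (R(a := R a - old + new));
          rest' = (\<lambda>b. image_mset (\<lambda>(j, y). (j, y + vacancy n L \<nu>' b j - vacancy n L \<nu> b j)) (rest b))
      in rest'(a := rest' a + new))"

definition RC_e :: "nat \<Rightarrow> mult_array \<Rightarrow> nat \<Rightarrow> rigged_config \<Rightarrow> rigged_config option" where
  "RC_e n L a R =
     (if \<exists>(i, x)\<in>#R a. x < 0
      then let x = Min (snd ` set_mset (R a));
               i = Min {i. (i, x) \<in># R a}
           in Some (replace_strings n L a {#(i, x)#} (string (i - 1) (x + 1)) R)
      else None)"

definition RC_f :: "nat \<Rightarrow> mult_array \<Rightarrow> nat \<Rightarrow> rigged_config \<Rightarrow> rigged_config option" where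
  "RC_f n L a R =
     (let R' =
        (if \<exists>(i, x)\<in>#R a. x \<le> 0
         then let x = Min (snd ` set_mset (R a));
                  i = Max {i. (i, x) \<in># R a}
              in replace_strings n L a {#(i, x)#} {#(i + 1, x - 1)#} R
         else replace_strings n L a {#} {#(1, -1)#} R)
      in if \<exists>b\<in>{1..<n}. \<exists>(i, x)\<in>#R' b. x > vacancy n L (shape R') b i then None else Some R')"

inductive_set RC :: "nat \<Rightarrow> mult_array \<Rightarrow> rigged_config set" for n L where
  base: "R \<in> RC_bar n L \<Longrightarrow> R \<in> RC n L"
| e: "\<lbrakk>R \<in> RC n L; a \<in> {1..<n}; RC_e n L a R = Some R'\<rbrakk> \<Longrightarrow> R' \<in> RC n L"
| f: "\<lbrakk>R \<in> RC n L; a \<in> {1..<n}; RC_f n L a R = Some R'\<rbrakk> \<Longrightarrow> R' \<in> RC n L"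

definition RC_crystal :: "nat \<Rightarrow> mult_array \<Rightarrow> rigged_config crystal" where
  "RC_crystal n L =
     \<lparr>elems = RC n L, cwt = RC_weight n L, e_op = RC_e n L, f_op = RC_f n L\<rparr>"

primrec iterate_option :: "nat \<Rightarrow> ('a \<Rightarrow> 'a option) \<Rightarrow> 'a \<Rightarrow> 'a option" where
  "iterate_option 0 g x = Some x"
| "iterate_option (Suc k) g x = Option.bind (g x) (iterate_option k g)"

text \<open>\<open>f_chain N L v k\<close> is \<open>f\<^sub>1\<close> to the power \<open>v\<^sub>1\<close>, after ..., after \<open>f\<^sub>k\<close> to the power
  \<open>v\<^sub>k\<close>, in type \<open>A\<close> of rank \<open>N - 1\<close>.\<close>

primrec f_chain :: "nat \<Rightarrow> mult_array \<Rightarrow> weight \<Rightarrow> nat \<Rightarrow> rigged_config \<Rightarrow> rigged_config option" where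
  "f_chain N L v 0 R = Some R"
| "f_chain N L v (Suc k) R =
     Option.bind (iterate_option (nat (v (Suc k))) (RC_f N L (Suc k)) R) (f_chain N L v k)"

definition smallest_singular ::
    "nat \<Rightarrow> mult_array \<Rightarrow> rigged_config \<Rightarrow> nat \<Rightarrow> nat \<Rightarrow> nat option" where
  "smallest_singular N L R k l =
     (let S = {i. l \<le> i \<and> (i, vacancy N L (shape R) k i) \<in># R k}
      in if S = {} then None else Some (Min S))"

text \<open>The selected lengths at the nodes \<open>k, k - 1, ..., 1\<close>, where the one at node \<open>k\<close> is to be
  at least \<open>l\<close>.\<close>

primrec select_lengths ::
    "nat \<Rightarrow> mult_array \<Rightarrow> rigged_config \<Rightarrow> nat \<Rightarrow> nat \<Rightarrow> (nat \<Rightarrow> nat) option" where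
  "select_lengths N L R 0 l = Some (\<lambda>_. 0)"
| "select_lengths N L R (Suc k) l =
     Option.bind (smallest_singular N L R (Suc k) l)
       (\<lambda>l'. map_option (\<lambda>len. len(Suc k := l')) (select_lengths N L R k l'))"

definition shorten_selected ::
    "nat \<Rightarrow> mult_array \<Rightarrow> (nat \<Rightarrow> nat) \<Rightarrow> rigged_config \<Rightarrow> rigged_config" where
  "shorten_selected N L len R =
     (let rest = (\<lambda>k. R k - {#(len k, vacancy N L (shape R) k (len k))#});
          \<nu>' = shape (\<lambda>k. if k \<in> {1..<N} then rest k + string (len k - 1) 0 else R k)
      in (\<lambda>k. if k \<in> {1..<N}
              then rest k + string (len k - 1) (vacancy N L \<nu>' k (len k - 1)) else R k))"

definition rho :: "nat \<Rightarrow> mult_array \<Rightarrow> rigged_config \<Rightarrow> rigged_config option" where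
  "rho N L R =
     map_option (\<lambda>len. shorten_selected N L len R) (select_lengths N L R (N - 1) 0)"

text \<open>\<open>None\<close> means that some step of the algorithm cannot be carried out, or that the last
  rigged partition of the result is not empty.\<close>

definition RC_pr :: "nat \<Rightarrow> mult_array \<Rightarrow> rigged_config \<Rightarrow> rigged_config option" where
  "RC_pr n L R =
     (let v = RC_weight n L R; N = n + 1; L' = L(n := (\<lambda>_. 0)) in
      Option.bind (f_chain N L' v n (R(n := {#})))
        (\<lambda>R'. Option.bind (iterate_option (nat (v n)) (rho N L') R')
          (\<lambda>R''. if R'' n = {#} then Some R'' else None)))"

end

theory Submission
  imports Defs
begin

text \<open>The point of the proof is that every string of every element of \<open>RC(L)\<close> is singular when
  \<open>L\<close> belongs to a single rectangle, and that the parts at node \<open>a\<close> are the numbers of letters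
  greater than \<open>a\<close> in the rows of a rectangular tableau, that is, a diagonal of its
  Gelfand--Tsetlin pattern. At a part, the vacancy number is linear in the entries of the pattern
  (\<open>lab\<close>), and \<open>f\<^sub>a\<close> raises the first entry of node \<open>a\<close> at which this linear function is
  minimal, both on rigged configurations and, by the bracketing rule, on tableaux; this determines
  \<open>\<Psi>\<close>. Step 1 of the algorithm shifts the pattern by one node, and each application of \<open>\<rho>\<close>
  decrements the entries along a lattice path, a jeu de taquin slide. A slide commutes with \<open>f\<^sub>c\<close>
  for all nodes \<open>c\<close> other than the first and the last, so that both maps of the theorem intertwine
  \<open>f\<^sub>a\<close> with \<open>f\<^sub>a\<^sub>+\<^sub>1\<close> for \<open>1 \<le> a \<le> n - 2\<close>. It remains to compare them on elements that are of
  highest weight for the nodes \<open>1, \<dots>, n - 2\<close>; these are determined by their number of letters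
  \<open>n\<close>, and so are their images, which are of highest weight for the nodes \<open>2, \<dots>, n - 1\<close>.\<close>

section \<open>Gelfand--Tsetlin patterns\<close>

text \<open>Singularity propagates: \<open>f_a\<close> keeps the colabels of the unselected strings,
  and for the selected one the vacancy number at the new length is exactly the old label minus one.
  Starting from the empty configuration, labels therefore carry no information, and every operator
  becomes a rule on lengths. Two kinds of pattern entries are not strings: zeros, and the entries
  near node 0 that are forced to equal \<open>s\<close>. Keeping both makes the rules uniform. A
  zero has label 0 and stands for the clause of \<open>f_a\<close> that creates a new string; the
  forced entries contribute to the vacancy numbers exactly the term of the multiplicity array. The
  price is that a slide must avoid forced entries. This is checked for one explicit family of paths,
  those of the highest weight elements, and then carried along the operators \<open>f_c\<close>. On
  these elements one parameter of the image remains open after the commutation relations have been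
  used; the weight condition of promotion at node 0 determines it.\<close>

definition pattern :: "nat \<Rightarrow> nat \<Rightarrow> nat \<Rightarrow> (nat \<Rightarrow> nat \<Rightarrow> nat) \<Rightarrow> bool" where
  "pattern N r s g \<longleftrightarrow>
     (\<forall>x<r. g 0 x = s) \<and> (\<forall>a x. N \<le> a \<or> r \<le> x \<longrightarrow> g a x = 0) \<and>
     (\<forall>a x. g (Suc a) x \<le> g a x) \<and> (\<forall>a x. g a (Suc x) \<le> g (Suc a) x)"

text \<open>Interlacing resolves every \<open>min\<close> in the vacancy number at length
  \<open>g a x\<close>, which leaves tail sums. As a function of the row it is also meaningful at
  entries that are not strings.\<close>

definition lab :: "nat \<Rightarrow> (nat \<Rightarrow> nat \<Rightarrow> nat) \<Rightarrow> nat \<Rightarrow> nat \<Rightarrow> int" where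
  "lab r g a x = (\<Sum>w\<in>{x..<r}. int (g (Suc a) w)) + (\<Sum>w\<in>{Suc x..<r}. int (g (a - 1) w))
     - (\<Sum>w\<in>{x..<r}. int (g a w)) - (\<Sum>w\<in>{Suc x..<r}. int (g a w))"

text \<open>The entries of a node weakly decrease with the row, so the first minimum is the longest
  string among those of smallest label, which is the one that \<open>f_a\<close> selects.\<close>

definition first_min :: "nat \<Rightarrow> (nat \<Rightarrow> nat \<Rightarrow> nat) \<Rightarrow> nat \<Rightarrow> nat \<Rightarrow> bool" where
  "first_min r g a q \<longleftrightarrow>
     q < r \<and> (\<forall>x<r. lab r g a q \<le> lab r g a x) \<and> (\<forall>x<q. lab r g a q < lab r g a x)"

definition bump :: "(nat \<Rightarrow> nat \<Rightarrow> nat) \<Rightarrow> nat \<Rightarrow> nat \<Rightarrow> nat \<Rightarrow> nat \<Rightarrow> nat" where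
  "bump g a q = g(a := (g a)(q := Suc (g a q)))"

lemma pattern_0: "pattern N r s g \<Longrightarrow> x < r \<Longrightarrow> g 0 x = s"
  and pattern_zero: "pattern N r s g \<Longrightarrow> N \<le> a \<or> r \<le> x \<Longrightarrow> g a x = 0"
  and pattern_node: "pattern N r s g \<Longrightarrow> g (Suc a) x \<le> g a x"
  and pattern_diag: "pattern N r s g \<Longrightarrow> g a (Suc x) \<le> g (Suc a) x"
  by (auto simp: pattern_def)

lemma pattern_node_pred: "pattern N r s g \<Longrightarrow> g a x \<le> g (a - 1) x"
  using pattern_node[of N r s g "a - 1" x] by (cases a) auto

lemma pattern_diag_pred: "pattern N r s g \<Longrightarrow> 0 < a \<Longrightarrow> g (a - 1) (Suc x) \<le> g a x"
  using pattern_diag[of N r s g "a - 1" x] by (cases a) auto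

lemma pattern_row: "pattern N r s g \<Longrightarrow> g a (Suc x) \<le> g a x"
  using pattern_node[of N r s g a x] pattern_diag[of N r s g a x] by linarith

lemma pattern_row_mono: "pattern N r s g \<Longrightarrow> x \<le> y \<Longrightarrow> g a y \<le> g a x"
  using lift_Suc_antimono_le[of "g a" x y] pattern_row by blast

lemma pattern_le: "pattern N r s g \<Longrightarrow> g a x \<le> s"
proof (induction a)
  case 0
  then show ?case by (cases "x < r") (auto simp: pattern_0 pattern_zero)
next
  case (Suc a)
  then show ?case using pattern_node[of N r s g a x] by linarith
qed

text \<open>In tableau terms: row \<open>x\<close> from the bottom has \<open>r - 1 - x\<close> rows
  above it, so column strictness makes all its letters at least \<open>r - x\<close>. Dually, they
  are at most \<open>N - x\<close>, which is \<open>pattern_empty\<close>.\<close>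

lemma pattern_full: "pattern N r s g \<Longrightarrow> a + x < r \<Longrightarrow> g a x = s"
proof (induction a arbitrary: x)
  case 0
  then show ?case by (simp add: pattern_0)
next
  case (Suc a)
  then have "g a (Suc x) = s" by simp
  then show ?case using pattern_diag[of N r s g a x] pattern_le[of N r s g "Suc a" x] Suc.prems(1)
    by simp
qed

lemma pattern_empty: "pattern N r s g \<Longrightarrow> N \<le> a + x \<Longrightarrow> g a x = 0"
proof (induction x arbitrary: a)
  case 0
  then show ?case by (simp add: pattern_zero)
next
  case (Suc x)
  then have "g (Suc a) x = 0" by simp
  then show ?case using pattern_diag[of N r s g a x] Suc.prems(1) by simp
qed

lemma lab_step:
  assumes "pattern N r s g" "x < r"
  shows "lab r g a x = lab r g a (Suc x) + int (g (Suc a) x) + int (g (a - 1) (Suc x))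
           - int (g a x) - int (g a (Suc x))"
proof (cases "Suc x < r")
  case True
  then show ?thesis using assms(2)
    by (simp add: lab_def sum.atLeast_Suc_lessThan)
next
  case False
  then have "r = Suc x" using assms(2) by simp
  then show ?thesis using assms by (simp add: lab_def pattern_zero)
qed

lemma lab_end: "r \<le> x \<Longrightarrow> lab r g a x = 0"
  by (simp add: lab_def)

lemma lab_last:
  assumes "pattern N r s g" "Suc x = r"
  shows "lab r g a x = int (g (Suc a) x) - int (g a x)"
  using assms by (simp add: lab_step[OF assms(1)] lab_end pattern_zero[OF assms(1)])

text \<open>A zero entry thus behaves like a string of length 0 and label 0, competing with the
  genuine strings for the minimum.\<close>

lemma lab_zero:
  assumes "pattern N r s g" "g a x = 0" "0 < a"
  shows "lab r g a x = 0"
proof -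
  have z: "g a w = 0" if "x \<le> w" for w
    using pattern_row_mono[OF assms(1) that, of a] assms(2) by simp
  have "g (Suc a) w = 0" if "x \<le> w" for w
    using pattern_node[OF assms(1), of a w] z[OF that] by simp
  moreover have "g (a - 1) w = 0" if "Suc x \<le> w" for w
    using pattern_diag_pred[OF assms(1,3), of "w - 1"] z[of "w - 1"] that by simp
  ultimately show ?thesis using z by (simp add: lab_def)
qed

lemma lab_cong:
  assumes "h (Suc a) = g (Suc b)" "h (a - 1) = g (b - 1)" "h a = g b"
  shows "lab r h a x = lab r g b x"
  using assms by (simp add: lab_def)

text \<open>The entry \<open>q\<close> occurs in both negative sums of \<open>lab\<close> if
  \<open>x < q\<close>, and only in the first of them if \<open>x = q\<close>.\<close>

lemma lab_bump:
  assumes "q < r" "0 < a"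
  shows "lab r (bump g a q) a x =
    lab r g a x - (if x = q then 1 else if x < q then 2 else 0)"
proof -
  have *: "int (bump g a q a w) = int (g a w) + (if w = q then 1 else 0)" for w
    by (simp add: bump_def)
  have "bump g a q (Suc a) = g (Suc a)" "bump g a q (a - 1) = g (a - 1)"
    using assms by (auto simp: bump_def)
  then show ?thesis using assms(1)
    by (auto simp: lab_def * sum.distrib)
qed

lemma first_min_exists:
  assumes "0 < r"
  obtains q where "first_min r g a q"
proof -
  let ?f = "lab r g a"
  define m where "m = Min (?f ` {..<r})"
  have "m \<in> ?f ` {..<r}" unfolding m_def using assms by (intro Min_in) auto
  then have ex: "\<exists>x. x < r \<and> ?f x = m" by auto
  define q where "q = (LEAST x. x < r \<and> ?f x = m)"
  have q: "q < r \<and> ?f q = m" unfolding q_def using ex by (rule LeastI_ex)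
  have le: "m \<le> ?f x" if "x < r" for x unfolding m_def using that by auto
  have "?f q < ?f x" if "x < q" for x
    using le[of x] q not_less_Least[of x "\<lambda>x. x < r \<and> ?f x = m"] that
    by (fold q_def) force
  then show thesis using that q le by (auto simp: first_min_def)
qed

lemma first_min_unique:
  assumes "first_min r g a q" "first_min r g a q'"
  shows "q = q'"
  using assms unfolding first_min_def by (metis linorder_neqE_nat not_less)

lemma pattern_bumpI:
  assumes "pattern N r s g" "0 < a" "a < N" "q < r" "g a q < g (a - 1) q"
    and "\<And>x. q = Suc x \<Longrightarrow> g a q < g (Suc a) x"
  shows "pattern N r s (bump g a q)"
proof -
  have 1: "bump g a q (Suc b) x \<le> bump g a q b x" for b x
    using assms(2,5) pattern_node[OF assms(1), of b x] by (auto simp: bump_def)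
  have 2: "bump g a q b (Suc x) \<le> bump g a q (Suc b) x" for b x
    using assms(6)[of x] pattern_diag[OF assms(1), of b x] by (auto simp: bump_def)
  show ?thesis using 1 2 assms(1-4) by (auto simp: pattern_def bump_def)
qed

lemma pattern_bumpD:
  assumes "pattern N r s (bump g a q)" "0 < a"
  shows "g a q < g (a - 1) q" "q = Suc x \<Longrightarrow> g a q < g (Suc a) x" "a < N" "q < r" "g a q < s"
proof -
  show "g a q < g (a - 1) q"
    using pattern_node_pred[OF assms(1), of a q] assms(2) by (simp add: bump_def split: if_splits)
  show "q = Suc x \<Longrightarrow> g a q < g (Suc a) x"
    using pattern_diag[OF assms(1), of a x] assms(2) by (simp add: bump_def split: if_splits)
  show "a < N" "q < r" using pattern_zero[OF assms(1), of a q]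
    by (auto simp: bump_def) (meson not_less)+
  show "g a q < s" using pattern_le[OF assms(1), of a q] by (simp add: bump_def)
qed

section \<open>Slides\<close>

text \<open>\<open>X a\<close> is the row of the path at node \<open>a\<close>, and the path is
  traced from node \<open>M\<close> down to node 1. It moves on by one row exactly when the diagonal
  inequality is a tie, since lowering the larger side alone would then violate it. The bound
  \<open>r \<le> a + X a\<close> keeps the path off the forced entries.\<close>

definition slide_path :: "nat \<Rightarrow> nat \<Rightarrow> (nat \<Rightarrow> nat \<Rightarrow> nat) \<Rightarrow> (nat \<Rightarrow> nat) \<Rightarrow> bool" where
  "slide_path r M g X \<longleftrightarrow>
     X M = 0 \<and> 0 < g M 0 \<and> (\<forall>a\<in>{1..M}. r \<le> a + X a) \<and>
     (\<forall>a\<in>{1..<M}. X a = (if g a (Suc (X (Suc a))) = g (Suc a) (X (Suc a))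
                          then Suc (X (Suc a)) else X (Suc a)))"

definition slide :: "nat \<Rightarrow> (nat \<Rightarrow> nat \<Rightarrow> nat) \<Rightarrow> (nat \<Rightarrow> nat) \<Rightarrow> nat \<Rightarrow> nat \<Rightarrow> nat" where
  "slide M g X = (\<lambda>a x. if a \<in> {1..M} \<and> x = X a then g a x - 1 else g a x)"

lemma slide_path_pos:
  assumes "pattern (Suc M) r s g" "slide_path r M g X" "1 \<le> a" "a \<le> M"
  shows "0 < g a (X a)"
  using assms(4,3)
proof (induction rule: inc_induct)
  case base
  then show ?case using assms(2) by (simp add: slide_path_def)
next
  case (step a)
  then have "X a = (if g a (Suc (X (Suc a))) = g (Suc a) (X (Suc a))
                    then Suc (X (Suc a)) else X (Suc a))"
    using assms(2) by (simp add: slide_path_def)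
  then show ?case using step pattern_node[OF assms(1), of a "X (Suc a)"] by (auto split: if_splits)
qed

lemma slide_path_less:
  assumes "pattern (Suc M) r s g" "slide_path r M g X" "1 \<le> a" "a \<le> M"
  shows "X a < r"
  using slide_path_pos[OF assms] pattern_zero[OF assms(1), of a "X a"] by (cases "X a < r") auto

lemma slide_path_step:
  assumes "slide_path r M g X" "1 \<le> a" "a < M"
  shows "X a = (if g a (Suc (X (Suc a))) = g (Suc a) (X (Suc a)) then Suc (X (Suc a)) else X (Suc a))"
  using assms by (simp add: slide_path_def)

lemma slide_path_low: "slide_path r M g X \<Longrightarrow> 1 \<le> a \<Longrightarrow> a \<le> M \<Longrightarrow> r \<le> a + X a"
  by (simp add: slide_path_def)

text \<open>Where the path increases its row it does so as soon as possible; this is what keeps the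
  pattern inequalities intact.\<close>

lemma slide_path_strict:
  assumes "pattern (Suc M) r s g" "slide_path r M g X" "1 \<le> a" "a < M" "X a = Suc (X (Suc a))"
  shows "g (Suc a) (X a) < g a (X a)"
proof -
  have *: "a < M \<longrightarrow> X a = Suc (X (Suc a)) \<longrightarrow> g (Suc a) (X a) < g a (X a)"
    if "a \<le> M" "1 \<le> a" for a
    using that
  proof (induction rule: inc_induct)
    case (step a)
    let ?x = "X (Suc a)"
    show ?case
    proof (intro impI)
      assume a: "a < M" "X a = Suc ?x"
      have eq: "g a (Suc ?x) = g (Suc a) ?x"
        using slide_path_step[OF assms(2) step(4,2)] a(2) by (simp split: if_splits)
      show "g (Suc a) (X a) < g a (X a)"
      proof (cases "Suc a = M")
        case True
        then have "g (Suc a) (X a) = 0"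
          using pattern_empty[OF assms(1), of "Suc a" "X a"] a(2) by simp
        then show ?thesis using slide_path_pos[OF assms(1,2) step(4)] a by simp
      next
        case False
        let ?y = "X (Suc (Suc a))"
        have path: "?x = (if g (Suc a) (Suc ?y) = g (Suc (Suc a)) ?y then Suc ?y else ?y)"
          using slide_path_step[OF assms(2), of "Suc a"] a(1) False by simp
        have le: "g (Suc a) (Suc ?x) \<le> g (Suc (Suc a)) ?x" "g (Suc (Suc a)) ?x \<le> g (Suc a) ?x"
          using pattern_diag[OF assms(1)] pattern_node[OF assms(1)] by auto
        have "g (Suc a) (Suc ?x) \<noteq> g (Suc a) ?x"
        proof (cases "?x = Suc ?y")
          case True
          then show ?thesis using step(3) a(1) False le by simp
        next
          case False
          then have "?y = ?x" "g (Suc a) (Suc ?x) \<noteq> g (Suc (Suc a)) ?x"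
            using path by metis+
          then show ?thesis using le by linarith
        qed
        then show ?thesis using eq a(2) pattern_row[OF assms(1), of "Suc a" ?x] by simp
      qed
    qed
  qed simp
  show ?thesis using * assms(3-5) by simp
qed

lemma pattern_slide:
  assumes "pattern (Suc M) r s g" "slide_path r M g X"
  shows "pattern (Suc M) r s (slide M g X)"
proof -
  have 1: "slide M g X (Suc a) x \<le> slide M g X a x" for a x
  proof (cases "1 \<le> a \<and> a \<le> M \<and> x = X a \<and> g (Suc a) x = g a x")
    case True
    note t = this
    show ?thesis
    proof (cases "a = M")
      case True
      then show ?thesis using t slide_path_pos[OF assms, of a] pattern_zero[OF assms(1), of "Suc a" x]
        by (simp add: slide_def)
    next
      case False
      then have "X a = X (Suc a)"
        using t slide_path_strict[OF assms, of a] slide_path_step[OF assms(2), of a]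
        by (auto split: if_splits)
      then show ?thesis using t False by (auto simp: slide_def)
    qed
  next
    case False
    then show ?thesis using pattern_node[OF assms(1), of a x] by (auto simp: slide_def)
  qed
  have 2: "slide M g X a (Suc x) \<le> slide M g X (Suc a) x" for a x
  proof (cases "Suc a \<le> M \<and> x = X (Suc a) \<and> g a (Suc x) = g (Suc a) x")
    case True
    show ?thesis
    proof (cases "a = 0")
      case a: True
      have "r \<le> Suc x" using slide_path_low[OF assms(2), of 1] True a by simp
      then show ?thesis using pattern_zero[OF assms(1), of a "Suc x"] a by (simp add: slide_def)
    next
      case False
      then show ?thesis using True slide_path_step[OF assms(2), of a] by (auto simp: slide_def)
    qed
  next
    case False
    then show ?thesis using pattern_diag[OF assms(1), of a x]
      by (cases "x = X (Suc a)") (auto simp: slide_def)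
  qed
  show ?thesis using 1 2 assms(1) by (auto simp: pattern_def slide_def)
qed

lemma lab_slide:
  assumes "pattern (Suc M) r s g" "slide_path r M g X" "1 \<le> a" "a \<le> M"
  shows "lab r (slide M g X) a x = lab r g a x
    + (if x \<le> X a then 1 else 0) + (if x < X a then 1 else 0)
    - (if a < M \<and> x \<le> X (Suc a) then 1 else 0) - (if 1 < a \<and> x < X (a - 1) then 1 else 0)"
proof -
  have *: "(\<Sum>w\<in>{y..<r}. int (slide M g X b w)) =
      (\<Sum>w\<in>{y..<r}. int (g b w)) - (if b \<in> {1..M} \<and> y \<le> X b then 1 else 0)" for b y
  proof (cases "b \<in> {1..M}")
    case True
    then have "int (slide M g X b w) = int (g b w) - (if w = X b then 1 else 0)" for w
      using slide_path_pos[OF assms(1,2), of b] by (auto simp: slide_def)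
    then show ?thesis using True slide_path_less[OF assms(1,2), of b] by (simp add: sum_subtractf)
  next
    case False
    then have "slide M g X b w = g b w" for w by (auto simp: slide_def)
    then show ?thesis using False by auto
  qed
  show ?thesis
    using assms(3,4) unfolding lab_def * by auto
qed

text \<open>The four corrections of \<open>lab_slide\<close> cancel off the path, as consecutive
  nodes of the path differ by at most one row. The bound on \<open>x\<close> acts at node 1, which
  has no predecessor on the path: there it leaves no row before \<open>X a\<close>.\<close>

lemma lab_slide_other:
  assumes "pattern (Suc M) r s g" "slide_path r M g X" "1 \<le> a" "a \<le> M" "r \<le> a + x" "x \<noteq> X a"
  shows "lab r (slide M g X) a x = lab r g a x"
proof (cases "x < X a")
  case True
  then have "a < M" using assms(2,4) by (cases "a = M") (auto simp: slide_path_def)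
  moreover have "1 < a" using True slide_path_less[OF assms(1-4)] assms(3,5) by (cases "a = 1") auto
  moreover have "x \<le> X (Suc a)" "x < X (a - 1)"
    using slide_path_step[OF assms(2), of a] slide_path_step[OF assms(2), of "a - 1"] True
      \<open>a < M\<close> \<open>1 < a\<close> by (auto split: if_splits)
  ultimately show ?thesis using lab_slide[OF assms(1-4), of x] True by simp
next
  case False
  then have "a < M \<Longrightarrow> \<not> x \<le> X (Suc a)" "1 < a \<Longrightarrow> \<not> x < X (a - 1)"
    using slide_path_step[OF assms(2), of a] slide_path_step[OF assms(2), of "a - 1"] assms(3,4,6)
    by (auto split: if_splits)
  then show ?thesis using lab_slide[OF assms(1-4), of x] False assms(6) by auto
qed

text \<open>The path changes only if the raised entry becomes equal to the preceding entry of the path,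
  and then only at the node \<open>c\<close>: this is the first case below. Otherwise the label of the
  entry of the path at \<open>c\<close> changes by at most one, according to the shape of the path around
  \<open>c\<close>, which does not affect the first minimum.\<close>

lemma slide_bump:
  assumes g: "pattern (Suc M) r s g" and X: "slide_path r M g X" and c: "2 \<le> c" "c < M"
    and q: "first_min r g c q" and gb: "pattern (Suc M) r s (bump g c q)"
  shows "\<exists>X' q'. slide_path r M (bump g c q) X' \<and> first_min r (slide M g X) c q' \<and>
           slide M (bump g c q) X' = bump (slide M g X) c q'"
proof -
  define u t v where "u = X (Suc c)" and "t = X c" and "v = X (c - 1)"
  have t: "t = (if g c (Suc u) = g (Suc c) u then Suc u else u)"
    using slide_path_step[OF X, of c] c by (simp add: u_def t_def)
  have v: "v = (if g (c - 1) (Suc t) = g c t then Suc t else t)"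
    using slide_path_step[OF X, of "c - 1"] c by (simp add: v_def t_def)
  have tr: "t < r" and ur: "u < r" and pos: "0 < g c t"
    using slide_path_less[OF g X, of c] slide_path_less[OF g X, of "Suc c"] slide_path_pos[OF g X, of c] c
    by (auto simp: t_def u_def)
  have L: "lab r (slide M g X) c x = lab r g c x
      + (if x = t then 1 - (if u = t then 1 else 0) - (if v = Suc t then 1 else 0) else 0)" for x
  proof -
    have "lab r (slide M g X) c x = lab r g c x
      + (if x \<le> t then 1 else 0) + (if x < t then 1 else 0)
      - (if x \<le> u then 1 else 0) - (if x < v then 1 else 0)"
      using lab_slide[OF g X, of c x] c by (simp add: t_def u_def v_def)
    moreover have "t = u \<or> t = Suc u" "v = t \<or> v = Suc t" using t v by presburger+
    ultimately show ?thesis by auto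
  qed
  have qr: "q < r" and qle: "\<And>x. x < r \<Longrightarrow> lab r g c q \<le> lab r g c x"
    and qlt: "\<And>x. x < q \<Longrightarrow> lab r g c q < lab r g c x"
    using q by (auto simp: first_min_def)
  have b1: "g c q < g (c - 1) q" and b2: "\<And>x. q = Suc x \<Longrightarrow> g c q < g (Suc c) x"
    using pattern_bumpD[OF gb] c by auto
  have step: "lab r g c x = lab r g c (Suc x) + int (g (Suc c) x) + int (g (c - 1) (Suc x))
           - int (g c x) - int (g c (Suc x))" if "x < r" for x
    using lab_step[OF g that] .
  have p1: "g c (Suc x) \<le> g (Suc c) x" "g (Suc c) x \<le> g c x" "g (c - 1) (Suc x) \<le> g c x"
    "g c x \<le> g (c - 1) x" for x
    using pattern_diag[OF g, of c x] pattern_node[OF g, of c x] pattern_diag_pred[OF g, of c x]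
      pattern_node_pred[OF g, of c x] c by auto
  show ?thesis
  proof (cases "q = Suc u \<and> Suc (g c (Suc u)) = g (Suc c) u")
    case True
    then have tu: "t = u" using t by auto
    have "lab r g c (Suc u) < lab r g c u" using qlt[of u] True by simp
    then have "g c u + g c (Suc u) < g (Suc c) u + g (c - 1) (Suc u)"
      using step[OF ur] by linarith
    then have "g (c - 1) (Suc u) = g c u" using True p1[of u] by linarith
    then have vu: "v = Suc u" using v tu by simp
    \<comment> \<open>Raising row \<open>Suc u\<close> creates the tie that sends the path at
      \<open>c\<close> one row further. Since \<open>v = Suc u\<close>, the two paths agree again at
      node \<open>c - 1\<close>.\<close>
    define X' where "X' = X(c := Suc u)"
    have m: "lab r g c u = lab r g c (Suc u) + 1"
      using step[OF ur] \<open>g (c - 1) (Suc u) = g c u\<close> True by linarith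
    have path: "slide_path r M (bump g c q) X'"
      unfolding slide_path_def
    proof (intro conjI ballI)
      show "X' M = 0" "0 < bump g c q M 0" using X c by (auto simp: X'_def slide_path_def bump_def)
      show "r \<le> a + X' a" if "a \<in> {1..M}" for a
        using slide_path_low[OF X, of a] slide_path_low[OF X, of c] that c tu
        by (auto simp: X'_def t_def)
      show "X' a = (if bump g c q a (Suc (X' (Suc a))) = bump g c q (Suc a) (X' (Suc a))
                          then Suc (X' (Suc a)) else X' (Suc a))" if "a \<in> {1..<M}" for a
      proof -
        consider "a = c" | "Suc a = c" | "a \<noteq> c" "Suc a \<noteq> c" by blast
        then show ?thesis
        proof cases
          case 1
          then show ?thesis using True c by (simp add: X'_def bump_def flip: u_def)
        next
          case 2
          then have "X a = Suc u" using vu v_def by force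
          moreover have "g (c - 1) (Suc (Suc u)) \<le> g c (Suc u)" using p1(3)[of "Suc u"] .
          then have "g a (Suc (Suc u)) \<noteq> Suc (g c (Suc u))" using 2 by force
          ultimately show ?thesis using 2 True by (auto simp: X'_def bump_def)
        next
          case 3
          then show ?thesis using slide_path_step[OF X, of a] that by (simp add: X'_def bump_def)
        qed
      qed
    qed
    \<comment> \<open>The slide lowers the label at \<open>u\<close> by one, which by
      \<open>m\<close> brings it level with the minimum at \<open>Suc u\<close>. Being earlier, row
      \<open>u\<close> becomes the first minimum.\<close>
    have "first_min r (slide M g X) c u"
      unfolding first_min_def L using m True tu vu ur qle qlt by fastforce
    moreover have "slide M (bump g c q) X' = bump (slide M g X) c u"
      using True tu pos c by (auto simp: fun_eq_iff slide_def bump_def X'_def simp flip: t_def)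
    ultimately show ?thesis using path by blast
  next
    case False
    \<comment> \<open>If the path left row \<open>q\<close> at node \<open>c - 1\<close>, minimality
      at \<open>q\<close> would force \<open>g (Suc c) q = g c (Suc q)\<close>. The path would then
      also have entered row \<open>q\<close> through a tie, and an entry at a tie cannot be
      raised.\<close>
    have vq: "q = t \<Longrightarrow> v = t"
    proof (rule ccontr)
      assume "q = t" "v \<noteq> t"
      then have e: "g (c - 1) (Suc t) = g c t" using v by (auto split: if_splits)
      have "lab r g c t \<le> lab r g c (Suc t)"
        using qle[of "Suc t"] \<open>q = t\<close> tr step[OF tr] e p1(1)[of t] lab_end[of r "Suc t" g c]
          pattern_zero[OF g, of c "Suc t"] lab_last[OF g, of t c] p1(2)[of t]
        by (cases "Suc t < r") (auto simp: not_less)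
      then have "g (Suc c) t = g c (Suc t)" using step[OF tr] e p1(1)[of t] by linarith
      then have "t \<noteq> u" using t by (metis n_not_Suc_n)
      then have "t = Suc u" "g c (Suc u) = g (Suc c) u" using t by (auto split: if_splits)
      then show False using b2[of u] \<open>q = t\<close> by simp
    qed
    have path: "slide_path r M (bump g c q) X"
      unfolding slide_path_def
    proof (intro conjI ballI)
      show "X M = 0" "0 < bump g c q M 0" using X c by (auto simp: slide_path_def bump_def)
      show "r \<le> a + X a" if "a \<in> {1..M}" for a
        using slide_path_low[OF X, of a] that by auto
      show "X a = (if bump g c q a (Suc (X (Suc a))) = bump g c q (Suc a) (X (Suc a))
                          then Suc (X (Suc a)) else X (Suc a))" if "a \<in> {1..<M}" for a
      proof -
        consider "a = c" | "Suc a = c" | "a \<noteq> c" "Suc a \<noteq> c" by blast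
        then show ?thesis
        proof cases
          case 1
          then show ?thesis using False c t b2[of u]
            by (auto simp: bump_def simp flip: u_def t_def)
        next
          case 2
          then have a: "a = c - 1" by simp
          show ?thesis
          proof (cases "q = t")
            case True
            have "v = t" using vq True by simp
            then have "g (c - 1) (Suc t) \<noteq> g c t" using v by (auto split: if_splits)
            then have "g (c - 1) (Suc t) \<noteq> Suc (g c t)" using p1(3)[of t] by simp
            then show ?thesis using 2 a True \<open>v = t\<close> v_def
              by (auto simp: bump_def simp flip: t_def)
          next
            case False
            then show ?thesis using 2 a v v_def by (auto simp: bump_def simp flip: t_def)
          qed
        next
          case 3
          then show ?thesis using slide_path_step[OF X, of a] that by (simp add: bump_def)
        qed
      qed
    qed
    have "first_min r (slide M g X) c q"
    proof -
      consider "u = t" "v = t" | "t = Suc u" "v = Suc t" | "u = t" "v = Suc t" | "t = Suc u" "v = t"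
        using t v by (auto split: if_splits)
      then show ?thesis
      proof cases
        case 1
        then have "lab r (slide M g X) c x = lab r g c x" for x using L[of x] by simp
        then show ?thesis using q by (simp add: first_min_def)
      next
        case 2
        then have "lab r (slide M g X) c x = lab r g c x" for x using L[of x] by simp
        then show ?thesis using q by (simp add: first_min_def)
      next
        case 3
        have e: "g (c - 1) (Suc t) = g c t" using v 3 by (auto split: if_splits)
        have e2: "g c (Suc t) < g (Suc c) t" using t 3 p1(1)[of t] by (auto split: if_splits)
        have gt: "lab r g c t = lab r g c (Suc t) + int (g (Suc c) t) - int (g c (Suc t))"
          using step[OF tr] e by simp
        have "q \<noteq> t" using vq 3 by auto
        have "Suc t < r"
          using gt e2 lab_last[OF g, of t c] p1(2)[of t] tr lab_end[of r "Suc t" g c]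
          by (cases "Suc t = r") auto
        then have le: "lab r g c q \<le> lab r g c (Suc t)" using qle by simp
        then have lt: "lab r g c q < lab r g c t" using gt e2 by simp
        \<comment> \<open>Here the label at \<open>t\<close> drops by one. Without the extra margin,
          \<open>q\<close> would be \<open>Suc t\<close> and one short of a tie, which is the case
          treated before.\<close>
        have lt2: "lab r g c q + 1 < lab r g c t" if "t < q"
        proof (rule ccontr)
          assume "\<not> ?thesis"
          then have "lab r g c (Suc t) = lab r g c q" "g (Suc c) t = Suc (g c (Suc t))"
            using gt e2 le by auto
          then have "q = Suc t" using qlt[of "Suc t"] that by force
          then show False using False 3 \<open>g (Suc c) t = Suc (g c (Suc t))\<close> by simp
        qed
        show ?thesis unfolding first_min_def L using qr qle qlt lt lt2 3 \<open>q \<noteq> t\<close> by fastforce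
      next
        case 4
        have "t \<noteq> q" using b2[of u] t 4 by auto
        then show ?thesis unfolding first_min_def L using qr qle qlt 4 by fastforce
      qed
    qed
    moreover have "slide M (bump g c q) X = bump (slide M g X) c q"
      using pos c by (auto simp: fun_eq_iff slide_def bump_def simp flip: t_def)
    ultimately show ?thesis using path by blast
  qed
qed

primrec slides :: "nat \<Rightarrow> nat \<Rightarrow> nat \<Rightarrow> (nat \<Rightarrow> nat \<Rightarrow> nat) \<Rightarrow> (nat \<Rightarrow> nat \<Rightarrow> nat) \<Rightarrow> bool" where
  "slides r M 0 g g' \<longleftrightarrow> g' = g"
| "slides r M (Suc k) g g' \<longleftrightarrow> (\<exists>X. slide_path r M g X \<and> slides r M k (slide M g X) g')"

lemma slides_bump:
  assumes "pattern (Suc M) r s g" "slides r M k g g'" "2 \<le> c" "c < M"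
    and "first_min r g c q" "pattern (Suc M) r s (bump g c q)"
  shows "\<exists>q'. first_min r g' c q' \<and> slides r M k (bump g c q) (bump g' c q')"
  using assms
proof (induction k arbitrary: g q)
  case (Suc k)
  from Suc.prems(2) obtain X where X: "slide_path r M g X" and k: "slides r M k (slide M g X) g'"
    by auto
  obtain X' q' where X': "slide_path r M (bump g c q) X'" and q': "first_min r (slide M g X) c q'"
    and eq: "slide M (bump g c q) X' = bump (slide M g X) c q'"
    using slide_bump[OF Suc.prems(1) X Suc.prems(3-6)] by blast
  have "pattern (Suc M) r s (bump (slide M g X) c q')"
    using pattern_slide[OF Suc.prems(6) X'] by (simp add: eq)
  then obtain q'' where "first_min r g' c q''"
      "slides r M k (bump (slide M g X) c q') (bump g' c q'')"
    using Suc.IH[OF pattern_slide[OF Suc.prems(1) X] k Suc.prems(3,4) q'] by blast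
  then show ?case using X' eq unfolding slides.simps by metis
qed auto

section \<open>Singular rigged configurations\<close>

definition vac :: "nat \<Rightarrow> (nat \<Rightarrow> nat \<Rightarrow> nat) \<Rightarrow> nat \<Rightarrow> nat \<Rightarrow> int" where
  "vac r g a i = (\<Sum>x<r. int (min i (g (a - 1) x))) + (\<Sum>x<r. int (min i (g (Suc a) x)))
     - 2 * (\<Sum>x<r. int (min i (g a x)))"

text \<open>For \<open>x < r - a\<close> the entry \<open>g a x\<close> is forced to be \<open>s\<close> and does not correspond to a string.\<close>

definition parts :: "nat \<Rightarrow> (nat \<Rightarrow> nat \<Rightarrow> nat) \<Rightarrow> nat \<Rightarrow> nat multiset" where
  "parts r g a = filter_mset (\<lambda>i. 0 < i) (image_mset (g a) (mset_set {r - a..<r}))"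

definition singular_rc :: "nat \<Rightarrow> nat \<Rightarrow> (nat \<Rightarrow> nat \<Rightarrow> nat) \<Rightarrow> rigged_config" where
  "singular_rc N r g =
     (\<lambda>a. if a \<in> {1..<N} then image_mset (\<lambda>i. (i, vac r g a i)) (parts r g a) else {#})"

lemma in_parts: "i \<in># parts r g a \<longleftrightarrow> 0 < i \<and> (\<exists>x<r. r \<le> a + x \<and> i = g a x)"
proof -
  have "x \<in> {r - a..<r} \<longleftrightarrow> x < r \<and> r \<le> a + x" for x by auto
  then show ?thesis by (auto simp: parts_def simp del: atLeastLessThan_iff)
qed

lemma shape_singular_rc:
  "shape (singular_rc N r g) = (\<lambda>a. if a \<in> {1..<N} then parts r g a else {#})"
  by (auto simp: shape_def singular_rc_def fun_eq_iff image_mset.compositionality comp_def)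

lemma sum_mset_parts:
  "(\<Sum>j\<in>#parts r g a. int (min i j)) = (\<Sum>x\<in>{r - a..<r}. int (min i (g a x)))"
proof -
  have "(\<Sum>j\<in>#filter_mset ((<) 0) A. int (min i j)) = (\<Sum>j\<in>#A. int (min i j))" for A :: "nat multiset"
    by (induction A) auto
  then show ?thesis
    by (simp add: parts_def image_mset.compositionality comp_def sum_unfold_sum_mset)
qed

lemma sum_over_parts:
  fixes f :: "nat \<Rightarrow> nat \<Rightarrow> int"
  assumes "\<And>b. f b 0 = 0"
  shows "(\<Sum>(b, j) | (b, j) \<in> H_index n \<and> count (\<nu> b) j \<noteq> 0. f b j * int (count (\<nu> b) j)) =
    (\<Sum>b\<in>{1..<n}. \<Sum>j\<in>#\<nu> b. f b j)"
proof -
  have eq: "{(b, j). (b, j) \<in> H_index n \<and> count (\<nu> b) j \<noteq> 0} =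
      Sigma {1..<n} (\<lambda>b. {j \<in> set_mset (\<nu> b). 1 \<le> j})"
    by (auto simp: H_index_def)
  have "(\<Sum>j\<in>{j \<in> set_mset A. 1 \<le> j}. f b j * int (count A j)) = (\<Sum>j\<in>#A. f b j)" for b A
  proof -
    \<comment> \<open>The index set \<open>S\<close> is fixed in advance so that it does not vary in
      the induction over \<open>A\<close>.\<close>
    have "(\<Sum>j\<in>#A. f b j) = (\<Sum>j\<in>S. f b j * int (count A j))" if "finite S" "set_mset A \<subseteq> S" for S
      using that(2)
    proof (induction A)
      case (add x A)
      have "f b j * int (count (add_mset x A) j) = f b j * int (count A j) + (if j = x then f b x else 0)" for j
        by (simp add: algebra_simps)
      then show ?case using add that(1) by (simp add: sum.distrib)
    qed simp
    from this[of "set_mset A"] have "(\<Sum>j\<in>#A. f b j) = (\<Sum>j\<in>set_mset A. f b j * int (count A j))"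
      by simp
    also have "\<dots> = (\<Sum>j\<in>{j \<in> set_mset A. 1 \<le> j}. f b j * int (count A j))"
      by (rule sum.mono_neutral_cong_right) (auto simp: assms intro!: Suc_leI gr0I)
    finally show ?thesis by simp
  qed
  then show ?thesis unfolding eq by (subst sum.Sigma[symmetric]) auto
qed

text \<open>The multiplicity array is encoded in the forced entries: node \<open>b\<close> has
  \<open>r - b\<close> of them (truncated subtraction), all equal to \<open>s\<close>, and the
  second difference of this number is 1 at node \<open>r\<close> and 0 at every other node.\<close>

lemma vacancy_singular_rc:
  assumes g: "pattern N r s g" and r: "1 \<le> r" "r < N" and a: "a \<in> {1..<N}"
  shows "vacancy N (KR_mult r s) (shape (singular_rc N r g)) a i = vac r g a i"
proof -
  let ?\<nu> = "shape (singular_rc N r g)"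
  define S where "S b = (\<Sum>x\<in>{r - b..<r}. int (min i (g b x)))" for b
  have full: "(\<Sum>x<r. int (min i (g b x))) = S b + int (r - b) * int (min i s)" for b
  proof -
    have "(\<Sum>x<r. int (min i (g b x))) = (\<Sum>x<r - b. int (min i (g b x))) + S b"
      using sum.atLeastLessThan_concat[of 0 "r - b" r "\<lambda>x. int (min i (g b x))"]
      by (simp add: S_def lessThan_atLeast0)
    also have "(\<Sum>x<r - b. int (min i (g b x))) = (\<Sum>x<r - b. int (min i s))"
      by (rule sum.cong) (auto simp: pattern_full[OF g])
    finally show ?thesis by simp
  qed
  have S0: "S 0 = 0" "S N = 0" using pattern_zero[OF g] by (auto simp: S_def)
  have "(\<Sum>(b, j) | (b, j) \<in> H_index N \<and> count (?\<nu> b) j \<noteq> 0. cartan a b * int (min i j * count (?\<nu> b) j))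
      = (\<Sum>b\<in>{1..<N}. \<Sum>j\<in>#?\<nu> b. cartan a b * int (min i j))"
    using sum_over_parts[where f = "\<lambda>b j. cartan a b * int (min i j)" and n = N and \<nu> = ?\<nu>] by (simp add: mult.assoc)
  also have "\<dots> = (\<Sum>b\<in>{1..<N}. cartan a b * S b)"
    by (rule sum.cong) (simp_all add: shape_singular_rc sum_mset_parts S_def
        flip: sum_mset_distrib_left)
  \<comment> \<open>Nodes 0 and \<open>N\<close>, where \<open>S\<close> vanishes, are added so that
    both neighbours of \<open>a\<close> lie in the range of summation.\<close>
  also have "\<dots> = (\<Sum>b\<in>{..N}. cartan a b * S b)"
  proof (rule sum.mono_neutral_left)
    show "\<forall>b\<in>{..N} - {1..<N}. cartan a b * S b = 0"
    proof
      fix b assume "b \<in> {..N} - {1..<N}"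
      then have "b = 0 \<or> b = N" by auto
      then show "cartan a b * S b = 0" using S0 by auto
    qed
  qed auto
  also have "\<dots> = (\<Sum>b\<in>{..N}. (if b = a then 2 * S a else 0) - (if b = a - 1 then S (a - 1) else 0)
      - (if b = Suc a then S (Suc a) else 0))"
    using a by (intro sum.cong) (auto simp: cartan_def)
  also have "\<dots> = 2 * S a - S (a - 1) - S (Suc a)"
    using a by (simp add: sum_subtractf) auto
  finally have 1: "(\<Sum>(b, j) | (b, j) \<in> H_index N \<and> count (?\<nu> b) j \<noteq> 0. cartan a b * int (min i j * count (?\<nu> b) j))
      = 2 * S a - S (a - 1) - S (Suc a)" .
  have 2: "(\<Sum>j | 1 \<le> j \<and> KR_mult r s a j \<noteq> 0. int (min i j * KR_mult r s a j)) = (if a = r then int (min i s) else 0)"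
  proof (cases "a = r \<and> 1 \<le> s")
    case True
    then have "{j. 1 \<le> j \<and> KR_mult r s a j \<noteq> 0} = {s}" by (auto simp: KR_mult_def)
    then show ?thesis using True by (simp add: KR_mult_def)
  next
    case False
    then have e: "{j. 1 \<le> j \<and> KR_mult r s a j \<noteq> 0} = {}" by (auto simp: KR_mult_def)
    show ?thesis using False unfolding e by auto
  qed
  have 3: "int (r - (a - 1)) * c + int (r - Suc a) * c - 2 * (int (r - a) * c) = (if a = r then c else 0)" for c :: int
  proof (cases "a < r")
    case True
    then show ?thesis using a by (simp add: of_nat_diff algebra_simps)
  next
    case False
    then show ?thesis using a by auto
  qed
  show ?thesis
    unfolding vacancy_def 1 2 vac_def full using 3[of "int (min i s)"] by (simp add: algebra_simps)
qed

text \<open>By interlacing, the truncation acts on the first \<open>x\<close> rows at nodes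
  \<open>a\<close> and \<open>Suc a\<close>, and on the first \<open>Suc x\<close> rows at node
  \<open>a - 1\<close>. The surplus of one copy of \<open>g a x\<close> removes row \<open>x\<close>
  from one of the two sums at node \<open>a\<close>.\<close>

lemma vac_lab:
  assumes g: "pattern N r s g" and a: "0 < a" and x: "x < r"
  shows "vac r g a (g a x) = lab r g a x"
proof -
  let ?i = "g a x"
  have split: "(\<Sum>w<r. int (min ?i (g b w))) = int k * int ?i + (\<Sum>w\<in>{k..<r}. int (g b w))"
    if "k \<le> r" "\<And>w. w < k \<Longrightarrow> ?i \<le> g b w" "\<And>w. k \<le> w \<Longrightarrow> g b w \<le> ?i" for b k
  proof -
    have "(\<Sum>w<r. int (min ?i (g b w))) = (\<Sum>w<k. int (min ?i (g b w))) + (\<Sum>w\<in>{k..<r}. int (min ?i (g b w)))"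
      using sum.atLeastLessThan_concat[of 0 k r "\<lambda>w. int (min ?i (g b w))"] that(1)
      by (simp add: lessThan_atLeast0)
    also have "(\<Sum>w<k. int (min ?i (g b w))) = (\<Sum>w<k. int ?i)"
      by (rule sum.cong) (use that in \<open>auto simp: min_def\<close>)
    also have "(\<Sum>w\<in>{k..<r}. int (min ?i (g b w))) = (\<Sum>w\<in>{k..<r}. int (g b w))"
      by (rule sum.cong) (use that in auto)
    finally show ?thesis by simp
  qed
  have m: "g b y \<le> g b w" if "w \<le> y" for b w y using pattern_row_mono[OF g that] .
  have 1: "(\<Sum>w<r. int (min ?i (g a w))) = int x * int ?i + (\<Sum>w\<in>{x..<r}. int (g a w))"
    by (rule split) (use x m in auto)
  have 2: "(\<Sum>w<r. int (min ?i (g (Suc a) w))) = int x * int ?i + (\<Sum>w\<in>{x..<r}. int (g (Suc a) w))"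
  proof (rule split)
    show "?i \<le> g (Suc a) w" if "w < x" for w
      using pattern_diag[OF g, of a w] m[of "Suc w" x a] that by simp
    show "g (Suc a) w \<le> ?i" if "x \<le> w" for w
      using pattern_node[OF g, of a w] m[of x w a] that by simp
  qed (use x in auto)
  have 3: "(\<Sum>w<r. int (min ?i (g (a - 1) w))) = int (Suc x) * int ?i + (\<Sum>w\<in>{Suc x..<r}. int (g (a - 1) w))"
  proof (rule split)
    show "?i \<le> g (a - 1) w" if "w < Suc x" for w
      using pattern_node_pred[OF g, of a w] m[of w x a] that by simp
    show "g (a - 1) w \<le> ?i" if "Suc x \<le> w" for w
      using pattern_diag_pred[OF g a, of x] m[of "Suc x" w "a - 1"] that by simp
  qed (use x in auto)
  have "(\<Sum>w\<in>{x..<r}. int (g a w)) = int ?i + (\<Sum>w\<in>{Suc x..<r}. int (g a w))"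
    using x by (simp add: sum.atLeast_Suc_lessThan)
  then show ?thesis unfolding vac_def lab_def 1 2 3 by (simp add: algebra_simps)
qed

section \<open>Lowering operators on singular rigged configurations\<close>

text \<open>Untouched strings keep colabel 0 and so stay singular; only the new strings
  \<open>Q\<close> have to be given the right labels.\<close>

lemma replace_strings_singular_rc:
  assumes g: "pattern N r s g" and h: "pattern N r s h" and r: "1 \<le> r" "r < N" and a: "a \<in> {1..<N}"
    and off: "\<And>b. b \<noteq> a \<Longrightarrow> h b = g b" and P: "P \<subseteq># parts r g a"
    and Q: "parts r h a = parts r g a - P + Q"
  shows "replace_strings N (KR_mult r s) a (image_mset (\<lambda>i. (i, vac r g a i)) P)
           (image_mset (\<lambda>i. (i, vac r h a i)) Q) (singular_rc N r g) = singular_rc N r h"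
proof -
  let ?R = "singular_rc N r g" and ?old = "image_mset (\<lambda>i. (i, vac r g a i)) P"
    and ?new = "image_mset (\<lambda>i. (i, vac r h a i)) Q"
  have rest: "?R a - ?old = image_mset (\<lambda>i. (i, vac r g a i)) (parts r g a - P)"
    using a P by (simp add: singular_rc_def image_mset_Diff)
  have off_parts: "parts r h b = parts r g b" if "b \<noteq> a" for b
    using off[OF that] by (simp add: parts_def)
  have shp: "shape (?R(a := ?R a - ?old + ?new)) = shape (singular_rc N r h)"
  proof
    fix b
    show "shape (?R(a := ?R a - ?old + ?new)) b = shape (singular_rc N r h) b"
    proof (cases "b = a")
      case True
      have "shape (?R(a := ?R a - ?old + ?new)) a = parts r g a - P + Q"
        by (simp add: shape_def rest image_mset.compositionality comp_def)
      then show ?thesis using True a Q by (simp add: shape_singular_rc)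
    next
      case False
      then have "shape (?R(a := ?R a - ?old + ?new)) b = shape ?R b" by (simp add: shape_def)
      then show ?thesis using False off_parts by (simp add: shape_singular_rc)
    qed
  qed
  have vg: "vacancy N (KR_mult r s) (shape ?R) b i = vac r g b i"
    and vh: "vacancy N (KR_mult r s) (shape (singular_rc N r h)) b i = vac r h b i"
    if "b \<in> {1..<N}" for b i
    using vacancy_singular_rc[OF g r that] vacancy_singular_rc[OF h r that] by auto
  have upd: "image_mset (\<lambda>(j, y). (j, y + vacancy N (KR_mult r s) (shape (singular_rc N r h)) b j
        - vacancy N (KR_mult r s) (shape ?R) b j)) (image_mset (\<lambda>i. (i, vac r g b i)) A)
      = image_mset (\<lambda>i. (i, vac r h b i)) A" if "b \<in> {1..<N}" for b A
    using vg[OF that] vh[OF that] by (simp add: image_mset.compositionality comp_def)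
  have sing: "singular_rc N r f b = image_mset (\<lambda>i. (i, vac r f b i)) (parts r f b)"
    if "b \<in> {1..<N}" for f b
    using that by (simp add: singular_rc_def)
  show ?thesis
    unfolding replace_strings_def Let_def shp
  proof
    fix b
    consider "b = a" | "b \<noteq> a" "b \<in> {1..<N}" | "b \<noteq> a" "b \<notin> {1..<N}" by blast
    then show "((\<lambda>b. image_mset (\<lambda>(j, y). (j, y + vacancy N (KR_mult r s) (shape (singular_rc N r h)) b j
        - vacancy N (KR_mult r s) (shape ?R) b j)) ((?R(a := ?R a - ?old)) b))
      (a := image_mset (\<lambda>(j, y). (j, y + vacancy N (KR_mult r s) (shape (singular_rc N r h)) a j
        - vacancy N (KR_mult r s) (shape ?R) a j)) ((?R(a := ?R a - ?old)) a) + ?new)) b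
      = singular_rc N r h b"
    proof cases
      case 1
      then show ?thesis using upd[OF a] Q by (simp add: rest sing[OF a, of h])
    next
      case 2
      then show ?thesis using upd[OF 2(2)] off_parts[OF 2(1)] by (simp add: sing[OF 2(2)])
    next
      case 3
      then show ?thesis by (auto simp: singular_rc_def)
    qed
  qed
qed

lemma in_singular_rc:
  assumes "pattern N r s g" "a \<in> {1..<N}"
  shows "(i, x) \<in># singular_rc N r g a \<longleftrightarrow>
    (\<exists>w<r. r \<le> a + w \<and> 0 < g a w \<and> i = g a w \<and> x = lab r g a w)"
proof -
  have "(i, x) \<in># singular_rc N r g a \<longleftrightarrow> i \<in># parts r g a \<and> x = vac r g a i"
    using assms(2) by (auto simp: singular_rc_def)
  then show ?thesis using vac_lab[OF assms(1), of a] assms(2) unfolding in_parts by auto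
qed

lemma parts_bump:
  assumes "q < r" "r \<le> a + q"
  shows "parts r (bump g a q) a =
    parts r g a - (if g a q = 0 then {#} else {#g a q#}) + {#Suc (g a q)#}"
proof -
  have "mset_set {r - a..<r} = add_mset q (mset_set ({r - a..<r} - {q}))"
    using assms by (subst mset_set.remove[of _ q]) auto
  moreover have "image_mset (bump g a q a) (mset_set ({r - a..<r} - {q})) =
      image_mset (g a) (mset_set ({r - a..<r} - {q}))"
    by (rule image_mset_cong) (auto simp: bump_def)
  ultimately show ?thesis by (simp add: parts_def) (simp add: bump_def)
qed

lemma first_min_nonpos:
  assumes "pattern N r s g" "first_min r g a q"
  shows "lab r g a q \<le> 0"
proof -
  have "q < r" using assms(2) by (simp add: first_min_def)
  then have "lab r g a q \<le> lab r g a (r - 1)" using assms(2) by (simp add: first_min_def)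
  also have "\<dots> \<le> 0" using lab_last[OF assms(1), of "r - 1" a] pattern_node[OF assms(1), of a "r - 1"] \<open>q < r\<close>
    by simp
  finally show ?thesis .
qed

lemma RC_f_singular_rc:
  assumes g: "pattern N r s g" and r: "1 \<le> r" "r < N" and a: "a \<in> {1..<N}"
    and q: "first_min r g a q" and h: "pattern N r s (bump g a q)"
  shows "RC_f N (KR_mult r s) a (singular_rc N r g) = Some (singular_rc N r (bump g a q))"
proof -
  let ?R = "singular_rc N r g" and ?h = "bump g a q" and ?b = "g a q" and ?l = "lab r g a q"
  have a0: "0 < a" using a by simp
  have qr: "q < r" using q by (simp add: first_min_def)
  \<comment> \<open>An entry that can be raised is below \<open>s\<close>, hence not forced: it is a
    string or a zero.\<close>
  have ra: "r \<le> a + q" using pattern_bumpD(5)[OF h a0] pattern_full[OF g, of a q] by force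
  have off: "?h b = g b" if "b \<noteq> a" for b using that by (simp add: bump_def)
  have new: "vac r ?h a (Suc ?b) = ?l - 1"
    using vac_lab[OF h a0 qr] lab_bump[OF qr a0, of g q] by (simp add: bump_def)
  note mem = in_singular_rc[OF g a]
  have "(if \<exists>(i, x)\<in>#?R a. x \<le> 0
         then let x = Min (snd ` set_mset (?R a));
                  i = Max {i. (i, x) \<in># ?R a}
              in replace_strings N (KR_mult r s) a {#(i, x)#} {#(i + 1, x - 1)#} ?R
         else replace_strings N (KR_mult r s) a {#} {#(1, -1)#} ?R) = singular_rc N r ?h"
  \<comment> \<open>If the first minimum is a zero entry, all strings lie in earlier rows and have
    labels strictly above 0; this is exactly the clause that creates a string.\<close>
  proof (cases "?b = 0")
    case True
    have "0 < x" if "(i, x) \<in># ?R a" for i x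
    proof -
      obtain w where w: "w < r" "0 < g a w" "x = lab r g a w"
        using \<open>(i, x) \<in># ?R a\<close> unfolding mem by metis
      then have "w < q" using pattern_row_mono[OF g, of q w a] True by (metis not_gr_zero not_le order.strict_iff_order le_zero_eq)
      then show ?thesis using q w lab_zero[OF g True a0] by (simp add: first_min_def)
    qed
    then have "\<not> (\<exists>(i, x)\<in>#?R a. x \<le> 0)" by force
    moreover have "vac r ?h a 1 = -1" using new lab_zero[OF g True a0] True by simp
    moreover have "parts r ?h a = parts r g a - {#} + {#1#}"
      using parts_bump[OF qr ra, of g] True by simp
    ultimately show ?thesis
      using replace_strings_singular_rc[OF g h r a off, of "{#}" "{#1#}"] by simp
  next
    case False
    have mem_q: "(?b, ?l) \<in># ?R a" using mem qr ra False by auto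
    have le: "?l \<le> x" if "(i, x) \<in># ?R a" for i x
      using that q mem by (auto simp: first_min_def)
    have ex: "\<exists>(i, x)\<in>#?R a. x \<le> 0" using mem_q first_min_nonpos[OF g q] by force
    have 1: "Min (snd ` set_mset (?R a)) = ?l"
      using le by (intro Min_eqI) (auto intro: rev_image_eqI[OF mem_q])
    have 2: "Max {i. (i, ?l) \<in># ?R a} = ?b"
    proof (rule Max_eqI)
      have "{i. (i, ?l) \<in># ?R a} \<subseteq> fst ` set_mset (?R a)" by force
      then show "finite {i. (i, ?l) \<in># ?R a}" by (rule finite_subset) simp
      show "i \<le> ?b" if "i \<in> {i. (i, ?l) \<in># ?R a}" for i
      proof -
        have "(i, ?l) \<in># ?R a" using that by simp
        then obtain w where w: "w < r" "i = g a w" "lab r g a w = ?l" unfolding mem by metis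
        then have "q \<le> w" using q by (force simp: first_min_def not_less[symmetric])
        then show ?thesis using pattern_row_mono[OF g] w by simp
      qed
    qed (use mem_q in simp)
    have old: "{#(?b, ?l)#} = image_mset (\<lambda>i. (i, vac r g a i)) {#?b#}"
      using vac_lab[OF g a0 qr] by simp
    have upd: "{#(?b + 1, ?l - 1)#} = image_mset (\<lambda>i. (i, vac r ?h a i)) {#Suc ?b#}"
      using new by simp
    have "replace_strings N (KR_mult r s) a {#(?b, ?l)#} {#(?b + 1, ?l - 1)#} ?R = singular_rc N r ?h"
      unfolding old upd
    proof (rule replace_strings_singular_rc[OF g h r a off])
      show "{#?b#} \<subseteq># parts r g a" using in_parts[of ?b r g a] qr ra False by auto
      show "parts r ?h a = parts r g a - {#?b#} + {#Suc ?b#}"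
        using parts_bump[OF qr ra, of g] False by simp
    qed
    then show ?thesis using ex by (simp only: 1 2 Let_def if_True)
  qed
  \<comment> \<open>Singular strings satisfy the validity condition with equality.\<close>
  moreover have "\<not> (\<exists>b\<in>{1..<N}. \<exists>(i, x)\<in>#singular_rc N r ?h b.
      x > vacancy N (KR_mult r s) (shape (singular_rc N r ?h)) b i)"
    using vacancy_singular_rc[OF h r] by (auto simp: singular_rc_def)
  ultimately show ?thesis unfolding RC_f_def Let_def by simp
qed

section \<open>The algorithm \<open>rho\<close> as a slide\<close>

lemma smallest_singular_singular_rc:
  assumes "pattern N r s g" "1 \<le> r" "r < N" "k \<in> {1..<N}"
    and "t < r" "r \<le> k + t" "0 < g k t" "l \<le> g k t"
    and "\<And>w. w < r \<Longrightarrow> r \<le> k + w \<Longrightarrow> l \<le> g k w \<Longrightarrow> 0 < g k w \<Longrightarrow> g k t \<le> g k w"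
  shows "smallest_singular N (KR_mult r s) (singular_rc N r g) k l = Some (g k t)"
proof -
  let ?S = "{i. l \<le> i \<and> (i, vacancy N (KR_mult r s) (shape (singular_rc N r g)) k i)
      \<in># singular_rc N r g k}"
  have S: "?S = {i. l \<le> i \<and> i \<in># parts r g k}"
    using vacancy_singular_rc[OF assms(1-4)] assms(4) by (auto simp: singular_rc_def)
  have "g k t \<in> ?S" unfolding S in_parts using assms(5-8) by auto
  moreover have "Min ?S = g k t"
  proof (rule Min_eqI)
    show "finite ?S" unfolding S by (rule finite_subset[of _ "set_mset (parts r g k)"]) auto
    show "g k t \<le> i" if "i \<in> ?S" for i
      using that assms(9) unfolding S in_parts by auto
  qed fact
  ultimately have "?S \<noteq> {}" "Min ?S = g k t" by blast+
  then show ?thesis unfolding smallest_singular_def Let_def by (simp only: if_False)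
qed

text \<open>With every string singular, the search at a node is for the shortest part not shorter
  than the part selected before, say in row \<open>x\<close>. By interlacing all rows up to
  \<open>x\<close> qualify, and a later row only if it has this very length, which requires the tie
  in \<open>slide_path\<close>.\<close>

lemma select_lengths_slide_path:
  assumes g: "pattern (Suc M) r s g" and r: "1 \<le> r" "r \<le> M" and X: "slide_path r M g X"
  shows "select_lengths (Suc M) (KR_mult r s) (singular_rc (Suc M) r g) M 0 =
    Some (\<lambda>a. if a \<in> {1..M} then g a (X a) else 0)"
proof -
  let ?sel = "select_lengths (Suc M) (KR_mult r s) (singular_rc (Suc M) r g)"
  have r': "r < Suc M" using r by simp
  have inner: "?sel k (g (Suc k) (X (Suc k))) = Some (\<lambda>a. if a \<in> {1..k} then g a (X a) else 0)"
    if "k < M" for k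
    using that
  proof (induction k)
    case (Suc k)
    let ?k = "Suc k" and ?u = "X (Suc (Suc k))"
    have t: "X ?k = (if g ?k (Suc ?u) = g (Suc ?k) ?u then Suc ?u else ?u)"
      using slide_path_step[OF X, of ?k] Suc.prems by simp
    have "smallest_singular (Suc M) (KR_mult r s) (singular_rc (Suc M) r g) ?k (g (Suc ?k) ?u)
        = Some (g ?k (X ?k))"
    proof (rule smallest_singular_singular_rc[OF g r(1) r'])
      show "?k \<in> {1..<Suc M}" "X ?k < r" "r \<le> ?k + X ?k" "0 < g ?k (X ?k)"
        using Suc.prems slide_path_less[OF g X, of ?k] slide_path_low[OF X, of ?k]
          slide_path_pos[OF g X, of ?k] by auto
      show "g (Suc ?k) ?u \<le> g ?k (X ?k)" using t pattern_node[OF g, of ?k ?u] by simp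
      show "g ?k (X ?k) \<le> g ?k w" if "w < r" "g (Suc ?k) ?u \<le> g ?k w" for w
      proof (cases "w \<le> X ?k")
        case True
        then show ?thesis using pattern_row_mono[OF g] by simp
      next
        case False
        show ?thesis
        proof (cases "X ?k = Suc ?u")
          case True
          then show ?thesis using t that by (auto split: if_splits)
        next
          case xk: False
          then have "X ?k = ?u" "g ?k (Suc ?u) \<noteq> g (Suc ?k) ?u" using t by (auto split: if_splits)
          then show ?thesis
            using that False pattern_row_mono[OF g, of "Suc ?u" w ?k] pattern_diag[OF g, of ?k ?u] by simp
        qed
      qed
    qed
    then show ?case using Suc.IH Suc.prems by (auto simp: fun_eq_iff le_Suc_eq)
  qed (simp add: fun_eq_iff)
  obtain k where k: "M = Suc k" using r by (cases M) auto
  have "smallest_singular (Suc M) (KR_mult r s) (singular_rc (Suc M) r g) M 0 = Some (g M (X M))"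
  proof (rule smallest_singular_singular_rc[OF g r(1) r'])
    \<comment> \<open>At the last node only row 0 can be nonzero.\<close>
    show "g M (X M) \<le> g M w" if "0 < g M w" for w
      using that X pattern_empty[OF g, of M w] by (cases w) (auto simp: slide_path_def)
  qed (use X r in \<open>auto simp: slide_path_def\<close>)
  then show ?thesis using inner[of k] unfolding k by (auto simp: fun_eq_iff le_Suc_eq)
qed

text \<open>\<open>rho\<close> leaves the labels of unselected strings alone, whereas singularity
  refers to the new vacancy numbers. By \<open>lab_slide_other\<close> these agree with the old ones
  at every part off the path.\<close>

lemma rho_singular_rc:
  assumes g: "pattern (Suc M) r s g" and r: "1 \<le> r" "r \<le> M" and X: "slide_path r M g X"
  shows "rho (Suc M) (KR_mult r s) (singular_rc (Suc M) r g) =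
    Some (singular_rc (Suc M) r (slide M g X))"
proof -
  let ?R = "singular_rc (Suc M) r g" and ?h = "slide M g X"
  let ?len = "\<lambda>a. if a \<in> {1..M} then g a (X a) else 0"
  have h: "pattern (Suc M) r s ?h" using pattern_slide[OF g X] .
  have r': "r < Suc M" using r by simp
  define rest where "rest = (\<lambda>k. ?R k - {#(?len k, vacancy (Suc M) (KR_mult r s) (shape ?R) k (?len k))#})"
  have node: "rest k = image_mset (\<lambda>i. (i, vac r ?h k i)) (parts r g k - {#g k (X k)#}) \<and>
      parts r ?h k = parts r g k - {#g k (X k)#} + image_mset fst (string (g k (X k) - 1) y)"
    if k: "k \<in> {1..<Suc M}" for k y
  proof -
    let ?t = "X k" and ?A = "{r - k..<r} - {X k}"
    have t: "?t < r" "r \<le> k + ?t" "0 < g k ?t"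
      using k slide_path_less[OF g X, of k] slide_path_low[OF X, of k] slide_path_pos[OF g X, of k] by auto
    have A: "mset_set {r - k..<r} = add_mset ?t (mset_set ?A)"
      using t by (subst mset_set.remove[of _ ?t]) auto
    have same: "image_mset (?h k) (mset_set ?A) = image_mset (g k) (mset_set ?A)"
      by (rule image_mset_cong) (auto simp: slide_def)
    \<comment> \<open>Omitting a row instead of a length removes a single copy when the selected
      length is repeated.\<close>
    define P where "P = filter_mset (\<lambda>i. 0 < i) (image_mset (g k) (mset_set ?A))"
    have pg: "parts r g k = add_mset (g k ?t) P"
      using t by (simp add: parts_def A P_def)
    have ht: "?h k ?t = g k ?t - 1" using k by (auto simp: slide_def)
    have ph: "parts r ?h k = P + image_mset fst (string (g k ?t - 1) y)"
      by (simp add: parts_def A same P_def ht string_def)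
    have "vac r g k i = vac r ?h k i" if i: "i \<in># P" for i
    proof -
      have "i \<in> g k ` ?A" using i unfolding P_def by simp
      then obtain w where w: "w < r" "r - k \<le> w" "w \<noteq> ?t" "i = g k w" by fastforce
      then have "?h k w = g k w" by (auto simp: slide_def)
      then show ?thesis
        using vac_lab[OF g, of k w] vac_lab[OF h, of k w] lab_slide_other[OF g X, of k w] k w by auto
    qed
    then have "image_mset (\<lambda>i. (i, vac r g k i)) P = image_mset (\<lambda>i. (i, vac r ?h k i)) P"
      by (intro image_mset_cong) auto
    moreover have "rest k = image_mset (\<lambda>i. (i, vac r g k i)) P"
    proof -
      have "?R k = image_mset (\<lambda>i. (i, vac r g k i)) (parts r g k)" using k by (simp add: singular_rc_def)
      moreover have "?len k = g k ?t" using k by auto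
      ultimately show ?thesis
        unfolding rest_def using pg vacancy_singular_rc[OF g r(1) r' k] by simp
    qed
    ultimately show ?thesis using pg ph by simp
  qed
  have shp: "shape (\<lambda>k. if k \<in> {1..<Suc M} then rest k + string (?len k - 1) 0 else ?R k) =
      shape (singular_rc (Suc M) r ?h)"
  proof
    fix k
    show "shape (\<lambda>k. if k \<in> {1..<Suc M} then rest k + string (?len k - 1) 0 else ?R k) k =
      shape (singular_rc (Suc M) r ?h) k"
    proof (cases "k \<in> {1..<Suc M}")
      case True
      then have "?len k = g k (X k)" by auto
      then show ?thesis using node[OF True, of 0] True
        by (simp add: shape_def singular_rc_def image_mset.compositionality comp_def)
    next
      case False
      then show ?thesis by (auto simp add: shape_def singular_rc_def)
    qed
  qed
  have "shorten_selected (Suc M) (KR_mult r s) ?len ?R = singular_rc (Suc M) r ?h"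
    unfolding shorten_selected_def Let_def rest_def[symmetric] shp
  proof
    fix k
    show "(if k \<in> {1..<Suc M} then rest k + string (?len k - 1)
        (vacancy (Suc M) (KR_mult r s) (shape (singular_rc (Suc M) r ?h)) k (?len k - 1)) else ?R k)
      = singular_rc (Suc M) r ?h k"
    proof (cases "k \<in> {1..<Suc M}")
      case True
      then have "?len k = g k (X k)" by auto
      then show ?thesis
        using node[OF True, of 0] True vacancy_singular_rc[OF h r(1) r' True]
        by (simp add: singular_rc_def string_def)
    next
      case False
      then show ?thesis by (auto simp add: singular_rc_def)
    qed
  qed
  then show ?thesis
    unfolding rho_def using select_lengths_slide_path[OF g r X] by simp
qed

lemma iterate_rho_singular_rc:
  assumes "pattern (Suc M) r s g" "1 \<le> r" "r \<le> M" "slides r M k g g'"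
  shows "iterate_option k (rho (Suc M) (KR_mult r s)) (singular_rc (Suc M) r g) =
    Some (singular_rc (Suc M) r g')"
  using assms(1,4)
proof (induction k arbitrary: g)
  case (Suc k)
  then show ?case using rho_singular_rc[OF Suc.prems(1) assms(2,3)] pattern_slide[OF Suc.prems(1)]
    by auto
qed simp

section \<open>Replacing the entries of one node, and step 1 of the algorithm\<close>

lemma pattern_update:
  assumes g: "pattern N r s g" and c: "0 < c" "c < N"
    and "\<And>x. b x \<le> g (c - 1) x" "\<And>x. g (Suc c) x \<le> b x"
    and "\<And>x. g (c - 1) (Suc x) \<le> b x" "\<And>x. b (Suc x) \<le> g (Suc c) x"
  shows "pattern N r s (g(c := b))"
proof -
  have "(g(c := b)) (Suc a) x \<le> (g(c := b)) a x" for a x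
    using pattern_node[OF g, of a x] assms(4)[of x] assms(5)[of x] by auto
  moreover have "(g(c := b)) a (Suc x) \<le> (g(c := b)) (Suc a) x" for a x
    using pattern_diag[OF g, of a x] assms(6)[of x] assms(7)[of x] by auto
  moreover have "b x = 0" if "r \<le> x" for x
    using assms(4)[of x] pattern_zero[OF g, of "c - 1" x] that by simp
  ultimately show ?thesis using g c by (auto simp: pattern_def)
qed

text \<open>If there are no letters \<open>c + 1\<close> then \<open>f\<^sub>c\<close> turns the letters \<open>c\<close> into \<open>c + 1\<close> from the top
  row downwards.\<close>

lemma iterate_f_fill:
  assumes r: "1 \<le> r" "r < N" and c: "c \<in> {1..<N}"
    and low: "\<And>x. g (c - 1) (Suc x) \<le> g (Suc c) x"
  shows "pattern N r s g \<Longrightarrow> (\<forall>w<x0. g c w = g (Suc c) w) \<Longrightarrow> (\<forall>w>x0. g c w = g (c - 1) w) \<Longrightarrow>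
    (\<Sum>x<r. g (c - 1) x - g c x) = d \<Longrightarrow>
    iterate_option d (RC_f N (KR_mult r s) c) (singular_rc N r g) =
      Some (singular_rc N r (g(c := g (c - 1))))"
  using low
proof (induction d arbitrary: g x0)
  case 0
  have "g c x = g (c - 1) x" for x
  proof (cases "x < r")
    case True
    then have "g (c - 1) x \<le> g c x" using 0(4) by simp
    then show ?thesis using pattern_node_pred[OF 0(1), of c x] by (rule le_antisym[rotated])
  next
    case False
    then show ?thesis using pattern_zero[OF 0(1)] by simp
  qed
  then have "g (c - 1) = g c" by auto
  then have "g(c := g (c - 1)) = g" by (simp only: fun_upd_triv)
  then show ?case by simp
next
  case (Suc d)
  note g = Suc.prems(1)
  let ?D = "{x. x < r \<and> g c x < g (c - 1) x}"
  have "?D \<noteq> {}"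
  proof
    assume "?D = {}"
    have "(\<Sum>x<r. g (c - 1) x - g c x) = 0"
    proof (intro sum.neutral ballI)
      fix x assume "x \<in> {..<r}"
      then have "\<not> g c x < g (c - 1) x" using \<open>?D = {}\<close> by auto
      then show "g (c - 1) x - g c x = 0" by simp
    qed
    then show False using Suc.prems(4) by simp
  qed
  \<comment> \<open>Row \<open>q\<close> is the topmost one that still contains a letter
    \<open>c\<close>; no row below it contains a letter \<open>c + 1\<close> yet.\<close>
  define q where "q = Max ?D"
  have q: "q < r" "g c q < g (c - 1) q" using Max_in[OF _ \<open>?D \<noteq> {}\<close>] by (auto simp: q_def)
  have above: "g c w = g (c - 1) w" if "q < w" for w
  proof (cases "w < r")
    case True
    have "\<not> g c w < g (c - 1) w"
    proof
      assume "g c w < g (c - 1) w"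
      then have "w \<le> q" unfolding q_def using True by (intro Max_ge) auto
      then show False using that by simp
    qed
    then show ?thesis using pattern_node_pred[OF g, of c w] by simp
  next
    case False
    then show ?thesis using pattern_zero[OF g] by simp
  qed
  have "q \<le> x0" using Suc.prems(3) q(2) by (metis less_irrefl not_le)
  then have below: "g c w = g (Suc c) w" if "w < q" for w using Suc.prems(2) that by simp
  have c0: "0 < c" "c < N" using c by auto
  have h: "pattern N r s (bump g c q)"
  proof (rule pattern_bumpI[OF g c0 q])
    show "g c q < g (Suc c) x" if "q = Suc x" for x
      using Suc.prems(5)[of x] that q(2) by simp
  qed
  \<comment> \<open>From row \<open>x\<close> to \<open>Suc x\<close> the label grows by the number
    of letters \<open>c + 1\<close> in row \<open>x\<close> and falls by the number of letters
    \<open>c\<close> in row \<open>Suc x\<close>. From \<open>q\<close> on the latter vanishes,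
    before \<open>q\<close> the former.\<close>
  have up: "lab r g c x \<le> lab r g c (Suc x)" if "q \<le> x" "x < r" for x
    using lab_step[OF g, of x c] above[of "Suc x"] pattern_node[OF g, of c x] that by simp
  have down: "lab r g c (Suc x) \<le> lab r g c x \<and> (Suc x = q \<longrightarrow> lab r g c (Suc x) < lab r g c x)" if "x < q" for x
    using lab_step[OF g, of x c] below[OF that] that q pattern_node_pred[OF g, of c "Suc x"] by auto
  have min1: "lab r g c q \<le> lab r g c x" if "q \<le> x" "x < r" for x
    using that
  proof (induction rule: dec_induct)
    case (step x)
    then show ?case using up[of x] by simp
  qed simp
  have min2: "lab r g c (q - Suc i) > lab r g c q" if "Suc i \<le> q" for i
    using that
  proof (induction i)
    case 0
    then show ?case using down[of "q - 1"] by simp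
  next
    case (Suc i)
    then show ?case using down[of "q - Suc (Suc i)"] by (auto simp: Suc_diff_Suc)
  qed
  have fm: "first_min r g c q"
    unfolding first_min_def
  proof (intro conjI allI impI)
    show lt: "lab r g c q < lab r g c x" if "x < q" for x
      using min2[of "q - Suc x"] that by (simp add: Suc_diff_Suc)
    show "lab r g c q \<le> lab r g c x" if "x < r" for x
      using min1[of x] lt[of x] that by (cases "x < q") auto
  qed fact
  let ?h = "bump g c q"
  have nb: "?h (c - 1) = g (c - 1)" "?h (Suc c) = g (Suc c)" using c0 by (auto simp: bump_def)
  have "iterate_option d (RC_f N (KR_mult r s) c) (singular_rc N r ?h) =
      Some (singular_rc N r (?h(c := ?h (c - 1))))"
  proof (rule Suc.IH[OF h])
    show "\<forall>w<q. ?h c w = ?h (Suc c) w" unfolding nb using below by (simp add: bump_def)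
    show "\<forall>w>q. ?h c w = ?h (c - 1) w" unfolding nb using above by (simp add: bump_def)
    show "?h (c - 1) (Suc x) \<le> ?h (Suc c) x" for x unfolding nb by (rule Suc.prems(5))
    have "(\<Sum>x<r. g (c - 1) x - g c x) = (\<Sum>x<r. (g (c - 1) x - ?h c x) + (if x = q then 1 else 0))"
      using q by (intro sum.cong) (auto simp: bump_def)
    then show "(\<Sum>x<r. ?h (c - 1) x - ?h c x) = d"
      unfolding nb using Suc.prems(4) q(1) by (simp add: sum.distrib)
  qed
  moreover have "?h(c := ?h (c - 1)) = g(c := g (c - 1))" unfolding nb by (auto simp: bump_def)
  ultimately show ?case using RC_f_singular_rc[OF g r c fm h]
    by (simp only: iterate_option.simps Option.bind.simps)
qed

text \<open>The chain runs from node \<open>n\<close> down to node 1. When it reaches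
  \<open>c\<close>, node \<open>Suc c\<close> already carries the entries \<open>g c\<close>, so
  there is no letter \<open>c + 1\<close>; the exponent is the number of letters \<open>c\<close>,
  just enough to fill node \<open>c\<close> up to \<open>g (c - 1)\<close>.\<close>

lemma f_chain_singular_rc:
  assumes g: "pattern n r s g" and r: "1 \<le> r" "r < n"
    and v: "\<And>c. c \<in> {1..n} \<Longrightarrow> v c = (\<Sum>x<r. int (g (c - 1) x) - int (g c x))"
  shows "f_chain (Suc n) (KR_mult r s) v n (singular_rc (Suc n) r g) =
    Some (singular_rc (Suc n) r (\<lambda>a. g (a - 1)))"
proof -
  define h where "h k = (\<lambda>a. if k < a then g (a - 1) else g a)" for k
  have hp: "pattern (Suc n) r s (h k)" if "k \<le> n" for k
  proof -
    have "h k (Suc a) x \<le> h k a x" for a x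
      using pattern_node[OF g, of a x] pattern_node_pred[OF g, of a x] by (auto simp: h_def)
    moreover have "h k a (Suc x) \<le> h k (Suc a) x" for a x
      using pattern_diag[OF g, of a x] pattern_row[OF g, of a x] pattern_diag_pred[OF g, of a x]
      by (auto simp: h_def)
    moreover have "h k a x = 0" if "Suc n \<le> a \<or> r \<le> x" for a x
      using that \<open>k \<le> n\<close> pattern_zero[OF g, of "a - 1" x] pattern_zero[OF g, of a x]
      by (cases a) (auto simp: h_def)
    moreover have "h k 0 x = s" if "x < r" for x using that pattern_0[OF g] by (simp add: h_def)
    ultimately show ?thesis by (simp add: pattern_def)
  qed
  have "f_chain (Suc n) (KR_mult r s) v k (singular_rc (Suc n) r (h k)) = Some (singular_rc (Suc n) r (h 0))"
    if "k \<le> n" for k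
    using that
  proof (induction k)
    case (Suc k)
    let ?c = "Suc k" and ?h = "h (Suc k)"
    have nb: "?h ?c = g ?c" "?h (Suc ?c) = g ?c" "?h (?c - 1) = g k" by (auto simp: h_def)
    have "v ?c = (\<Sum>x<r. int (g k x) - int (g ?c x))" using v[of ?c] Suc.prems by simp
    also have "\<dots> = int (\<Sum>x<r. g k x - g ?c x)"
      unfolding of_nat_sum using pattern_node[OF g, of k] by (intro sum.cong) (auto simp: of_nat_diff)
    finally have d: "nat (v ?c) = (\<Sum>x<r. ?h (?c - 1) x - ?h ?c x)"
      unfolding nb by (simp only: nat_int)
    have "iterate_option (nat (v ?c)) (RC_f (Suc n) (KR_mult r s) ?c) (singular_rc (Suc n) r ?h) =
        Some (singular_rc (Suc n) r (?h(?c := ?h (?c - 1))))"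
    proof (rule iterate_f_fill[where ?x0.0 = r])
      show "?h (?c - 1) (Suc x) \<le> ?h (Suc ?c) x" for x unfolding nb using pattern_diag[OF g, of k x] .
      show "\<forall>w<r. ?h ?c w = ?h (Suc ?c) w" unfolding nb by simp
      show "\<forall>w>r. ?h ?c w = ?h (?c - 1) w" unfolding nb using pattern_zero[OF g] by simp
    qed (use hp Suc.prems r d in auto)
    moreover have "?h(?c := ?h (?c - 1)) = h k" unfolding nb by (auto simp: h_def)
    ultimately show ?case using Suc by simp
  qed simp
  moreover have "singular_rc (Suc n) r (h n) = singular_rc (Suc n) r g"
  proof -
    have "h n a = g a" for a using pattern_zero[OF g] by (cases a) (auto simp: h_def fun_eq_iff)
    then have "h n = g" by auto
    then show ?thesis by simp
  qed
  moreover have "h 0 = (\<lambda>a. g (a - 1))" by (auto simp: h_def)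
  ultimately show ?thesis by fastforce
qed

section \<open>Highest weight patterns\<close>

lemma last_min_exists:
  assumes "0 < r"
  obtains q where "q < r" "\<And>x. x < r \<Longrightarrow> lab r g a q \<le> lab r g a x"
    "\<And>x. q < x \<Longrightarrow> x < r \<Longrightarrow> lab r g a q < lab r g a x"
proof -
  let ?f = "lab r g a"
  define m where "m = Min (?f ` {..<r})"
  have le: "m \<le> ?f x" if "x < r" for x unfolding m_def using that by auto
  have "m \<in> ?f ` {..<r}" unfolding m_def using assms by (intro Min_in) auto
  then have ne: "{x. x < r \<and> ?f x = m} \<noteq> {}" by auto
  define q where "q = Max {x. x < r \<and> ?f x = m}"
  have q: "q < r" "?f q = m" using Max_in[OF _ ne] by (auto simp: q_def)
  have "?f q < ?f x" if "q < x" "x < r" for x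
  proof -
    have "?f x \<noteq> m"
    proof
      assume "?f x = m"
      then have "x \<le> q" unfolding q_def using that by (intro Max_ge) auto
      then show False using that by simp
    qed
    then show ?thesis using le[OF that(2)] q by simp
  qed
  then show thesis using that q le by blast
qed

text \<open>Lowering the last minimum \<open>q\<close> raises the labels by one at \<open>q\<close>
  and by two before it, so \<open>q\<close> becomes the first minimum. On patterns this is the rule
  for \<open>e_a\<close>.\<close>

lemma bump_predecessor:
  assumes g: "pattern N r s g" and a: "a \<in> {1..<N}" and neg: "x < r" "lab r g a x < 0"
  obtains g' q where "pattern N r s g'" "first_min r g' a q" "g = bump g' a q"
proof -
  obtain q where q: "q < r" "\<And>x. x < r \<Longrightarrow> lab r g a q \<le> lab r g a x"
    "\<And>x. q < x \<Longrightarrow> x < r \<Longrightarrow> lab r g a q < lab r g a x"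
    using last_min_exists[of r g a] neg(1) by (metis gr_implies_not0 not_gr_zero)
  have a0: "0 < a" "a < N" using a by auto
  \<comment> \<open>Beyond the last row \<open>lab\<close> is 0, which still exceeds the minimum
    because that is negative.\<close>
  have "lab r g a q < lab r g a (Suc q)"
    using q neg lab_end[of r "Suc q" g a] by (cases "Suc q < r") force+
  then have "g (Suc a) q + g (a - 1) (Suc q) < g a q + g a (Suc q)"
    using lab_step[OF g q(1), of a] by linarith
  then have big: "g (Suc a) q < g a q" "g (a - 1) (Suc q) < g a q"
    using pattern_diag[OF g, of a q] pattern_node_pred[OF g, of a "Suc q"] by linarith+
  define b where "b = (g a)(q := g a q - 1)"
  define g' where "g' = g(a := b)"
  have "pattern N r s g'"
    unfolding g'_def
  proof (rule pattern_update[OF g a0])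
    show "b x \<le> g (a - 1) x" for x
      using pattern_node_pred[OF g, of a x] by (auto simp: b_def)
    show "g (Suc a) x \<le> b x" for x
      using pattern_node[OF g, of a x] big by (auto simp: b_def)
    show "g (a - 1) (Suc x) \<le> b x" for x
      using pattern_diag_pred[OF g a0(1), of x] big by (auto simp: b_def)
    show "b (Suc x) \<le> g (Suc a) x" for x
      using pattern_diag[OF g, of a x] by (auto simp: b_def)
  qed
  moreover have eq: "g = bump g' a q" using big by (auto simp: bump_def g'_def b_def)
  moreover have "first_min r g' a q"
  proof -
    have "lab r g' a x = lab r g a x + (if x = q then 1 else if x < q then 2 else 0)" for x
      using lab_bump[OF q(1) a0(1), of g' x] eq by simp
    moreover have "lab r g a q + 1 < lab r g a x + 2" if "x < q" for x using q(1) q(2)[of x] that by simp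
    moreover have "lab r g a q + 1 \<le> lab r g a x" if "q < x" "x < r" for x using q(3)[OF that] by simp
    ultimately show ?thesis using q(1) unfolding first_min_def by (auto simp: not_less order.order_iff_strict)
  qed
  ultimately show thesis using that by blast
qed

text \<open>When the rows above contribute nothing, \<open>lab\<close> is the difference of two
  neighbouring entries of row \<open>x\<close>. Its nonnegativity opposes the monotonicity in the
  node, so the row is constant.\<close>

lemma highest_weight_row:
  assumes g: "pattern n r s g" and x: "x < r"
    and hw: "\<And>a. a \<in> {1..<m} \<Longrightarrow> 0 \<le> lab r g a x"
    and above: "\<And>w a. x < w \<Longrightarrow> r \<le> a + w \<Longrightarrow> g a w = 0"
    and a: "1 \<le> a" "r \<le> a + x" "a \<le> m"
  shows "g a x = g m x"
  using a(3,1,2)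
proof (induction rule: inc_induct)
  case (step a)
  have "int (g a x) \<le> int (g (Suc a) x)"
  proof -
    have "(\<Sum>w\<in>{Suc x..<r}. int (g b w)) = 0" if "a - 1 \<le> b" for b
      using above step(4,5) that by (intro sum.neutral) auto
    then have "lab r g a x = int (g (Suc a) x) - int (g a x)"
      using x by (simp add: lab_def sum.atLeast_Suc_lessThan)
    then show ?thesis using hw[of a] step by simp
  qed
  then show ?case using step pattern_node[OF g, of a x] by simp
qed simp

text \<open>The \<open>i\<close>-th row of the tableau from the top consists of letters
  \<open>i\<close>, except that the bottom row may end in letters \<open>n\<close>. Two instances
  matter: \<open>m = n\<close>, where all nodes are controlled and these letters disappear, and
  \<open>m = n - 1\<close>, where node \<open>n - 1\<close> is left free.\<close>

lemma highest_weight_pattern: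
  assumes g: "pattern n r s g" and r: "1 \<le> r" "r < n" and m: "r \<le> m" "m \<le> n" "n \<le> Suc m"
    and hw: "\<And>a x. a \<in> {1..<m} \<Longrightarrow> x < r \<Longrightarrow> 0 \<le> lab r g a x"
  shows "g = (\<lambda>a x. if r \<le> x then 0 else if a + x < r then s else if x = 0 \<and> a < n then g m 0 else 0)"
proof -
  have up: "g a x = 0" if "0 < x" "r \<le> a + x" for a x
    using that
  proof (induction "r - x" arbitrary: a x rule: less_induct)
    case less
    show ?case
    proof (cases "x < r")
      case True
      have above: "g a w = 0" if "x < w" "r \<le> a + w" for a w
        using less(1)[of w a] that True less(2) by simp
      have gm: "g m x = 0" using pattern_empty[OF g, of m x] m less(2) by simp
      show ?thesis
      proof (cases "a \<le> m")
        case a: True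
        have "g a x = g m x"
        proof (rule highest_weight_row[OF g True])
          show "0 \<le> lab r g a x" if "a \<in> {1..<m}" for a using hw that True by simp
        qed (use above a True less(3) in auto)
        then show ?thesis using gm by simp
      next
        case False
        then show ?thesis using pattern_empty[OF g, of a x] m by simp
      qed
    next
      case False
      then show ?thesis using pattern_zero[OF g] by simp
    qed
  qed
  have "g a 0 = g m 0" if "r \<le> a" "a < n" for a
  proof (rule highest_weight_row[OF g])
    show "0 \<le> lab r g a 0" if "a \<in> {1..<m}" for a using hw that r by simp
  qed (use up r m that in auto)
  then show ?thesis
    using up pattern_full[OF g] pattern_zero[OF g] r by (intro ext) (auto simp: not_less)
qed

text \<open>The columns of the tableau are \<open>1, ..., r\<close> and
  \<open>2, ..., r + 1\<close>, the latter occurring \<open>g 1 (r - 1)\<close> times.\<close>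

lemma shifted_highest_weight_pattern:
  assumes g: "pattern n r s g" and r: "1 \<le> r" "r < n"
    and hw: "\<And>a x. a \<in> {2..<n} \<Longrightarrow> x < r \<Longrightarrow> 0 \<le> lab r g a x"
  shows "g = (\<lambda>a x. if r \<le> x then 0 else if a + x < r then s else if a + x = r then g 1 (r - 1) else 0)"
proof -
  let ?c = "g 1 (r - 1)"
  have main: "(\<forall>a. r < a + x \<longrightarrow> g a x = 0) \<and> (\<forall>a. a + x = r \<longrightarrow> g a x = ?c)" if "x < r" for x
    \<comment> \<open>The outer induction goes from the top row downwards; inside, the entries of a
      row beyond the diagonal are shown to vanish from node \<open>n\<close> backwards.\<close>
    using that
  proof (induction "r - x" arbitrary: x rule: less_induct)
    case less
    have IH: "g a w = 0" if "x < w" "r < a + w" for a w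
      using less(1)[of w] that less(2) pattern_zero[OF g, of a w] by (cases "w < r") auto
    have IHc: "g a (Suc x) = ?c" if "a + Suc x = r" "0 < a" for a
      using less(1)[of "Suc x"] that less(2) by simp
    have zero: "g a x = 0" if "a \<le> n" "r < a + x" for a
      using that
    proof (induction rule: inc_induct)
      case base
      then show ?case using pattern_zero[OF g] by simp
    next
      case (step a)
      have "(\<Sum>w\<in>{Suc x..<r}. int (g b w)) = 0" if "a - 1 \<le> b" for b
        using IH step(4) that by (intro sum.neutral) auto
      then have "lab r g a x = int (g (Suc a) x) - int (g a x)"
        using less(2) by (simp add: lab_def sum.atLeast_Suc_lessThan)
      moreover have "a \<in> {2..<n}" using step less(2) by auto
      ultimately show ?case using hw[of a x] less(2) step by simp
    qed
    have zero': "g a x = 0" if "r < a + x" for a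
      using zero[of a] that pattern_zero[OF g, of a x] by (cases "a \<le> n") auto
    have "g a x = ?c" if a: "a + x = r" for a
    proof (cases "Suc x < r")
      case True
      then have "a \<in> {2..<n}" using a r by auto
      then have "0 \<le> lab r g a x" using hw less(2) by simp
      also have "lab r g a x = int ?c - int (g a x)"
      proof -
        have z: "(\<Sum>w\<in>{Suc x..<r}. int (g b w)) = 0" if "a \<le> b" for b
          using IH a that by (intro sum.neutral) auto
        have "(\<Sum>w\<in>{Suc (Suc x)..<r}. int (g (a - 1) w)) = 0"
          using IH a by (intro sum.neutral) auto
        then have "(\<Sum>w\<in>{Suc x..<r}. int (g (a - 1) w)) = int ?c"
          using True IHc[of "a - 1"] a by (simp add: sum.atLeast_Suc_lessThan)
        then show ?thesis
          using z zero'[of "Suc a"] less(2) a by (simp add: lab_def sum.atLeast_Suc_lessThan)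
      qed
      finally have "g a x \<le> ?c" by simp
      moreover have "?c \<le> g a x"
        using IHc[of "a - 1"] pattern_diag_pred[OF g, of a x] True a by simp
      ultimately show ?thesis by simp
    next
      case False
      then have "x = r - 1" "a = 1" using less(2) a by auto
      then show ?thesis by simp
    qed
    then show ?case using zero' by blast
  qed
  show ?thesis
  proof (intro ext)
    fix a x
    consider "r \<le> x" | "x < r" "a + x < r" | "x < r" "a + x = r" | "x < r" "r < a + x" by linarith
    then show "g a x = (if r \<le> x then 0 else if a + x < r then s else if a + x = r then ?c else 0)"
    proof cases
      case 1
      then show ?thesis using pattern_zero[OF g] by simp
    next
      case 2
      then show ?thesis using pattern_full[OF g] by simp
    next
      case 3
      then show ?thesis using main[of x] by simp
    next
      case 4
      then show ?thesis using main[of x] by simp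
    qed
  qed
qed

text \<open>All \<open>k\<close> slides use the same path \<open>r - a\<close> with truncated
  subtraction: it stays in the bottom row down to node \<open>r\<close> and then follows the
  diagonal \<open>a + x = r\<close>. After \<open>t\<close> slides the entries there are
  \<open>k - t\<close> and \<open>s - t\<close>, respectively.\<close>

lemma slides_highest_weight:
  assumes r: "1 \<le> r" "r < n" and k: "k \<le> s"
  shows "slides r n k
    (\<lambda>a x. if r \<le> x then 0 else if a - 1 + x < r then s else if x = 0 \<and> a - 1 < n then k else 0)
    (\<lambda>a x. if r \<le> x then 0 else if a + x < r then s else if a + x = r then s - k else 0)"
proof -
  define mid where "mid t = (\<lambda>a x. if r \<le> x then 0 else if a + x < r then s
    else if a + x = r then s - t else if x = 0 \<and> a \<le> n then k - t else 0)" for t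
  have step: "slide_path r n (mid t) (\<lambda>a. r - a)" "slide n (mid t) (\<lambda>a. r - a) = mid (Suc t)"
    if "t < k" for t
    using that r k by (auto simp: slide_path_def slide_def mid_def fun_eq_iff)
  have "slides r n d (mid t) (mid k)" if "t + d = k" for d t
    using that
  proof (induction d arbitrary: t)
    case (Suc d)
    then have "slides r n d (slide n (mid t) (\<lambda>a. r - a)) (mid k)" using step(2)[of t] by simp
    then show ?case using step(1)[of t] Suc.prems by auto
  qed simp
  from this[of 0 k] have "slides r n k (mid 0) (mid k)" by simp
  moreover have "mid 0 = (\<lambda>a x. if r \<le> x then 0 else if a - 1 + x < r then s
      else if x = 0 \<and> a - 1 < n then k else 0)"
    using r by (auto simp: mid_def fun_eq_iff)
  moreover have "mid k = (\<lambda>a x. if r \<le> x then 0 else if a + x < r then s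
      else if a + x = r then s - k else 0)"
    by (auto simp: mid_def fun_eq_iff)
  ultimately show ?thesis by simp
qed

section \<open>Bracketing and tableaux\<close>

definition excess :: "nat \<Rightarrow> nat list \<Rightarrow> int" where
  "excess a w = int (count_list w a) - int (count_list w (Suc a))"

lemma excess_Nil [simp]: "excess a [] = 0"
  and excess_append [simp]: "excess a (u @ v) = excess a u + excess a v"
  by (auto simp: excess_def)

lemma excess_take_Suc:
  "l < length w \<Longrightarrow> excess a (take (Suc l) w) = excess a (take l w) +
     (if w ! l = a then 1 else if w ! l = Suc a then -1 else 0)"
  by (simp add: take_Suc_conv_app_nth) (simp add: excess_def)

text \<open>With an opening bracket \<open>a + 1\<close> as a down step and a closing bracket \<open>a\<close> as an up step, the
  bracketed pairs are the excursions of the path strictly below its starting height.\<close>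

definition excursion :: "nat \<Rightarrow> nat list \<Rightarrow> nat \<Rightarrow> nat \<Rightarrow> bool" where
  "excursion a w j k \<longleftrightarrow> j < k \<and> k < length w \<and> w ! j = Suc a \<and> w ! k = a \<and>
     excess a (take (Suc k) w) = excess a (take j w) \<and>
     (\<forall>i. j < i \<and> i \<le> k \<longrightarrow> excess a (take i w) < excess a (take j w))"

text \<open>The partner of a closing bracket is the last earlier position at least as high as the
  end of step \<open>k\<close>; unit steps force equality there.\<close>

lemma excursion_to:
  assumes "k < length w" "w ! k = a" "l \<le> k" "excess a (take (Suc k) w) \<le> excess a (take l w)"
  shows "\<exists>j\<ge>l. excursion a w j k"
proof -
  let ?H = "\<lambda>i. excess a (take i w)"
  let ?S = "{i. i \<le> k \<and> ?H (Suc k) \<le> ?H i}"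
  define j where "j = Max ?S"
  have fin: "finite ?S" by simp
  have "l \<in> ?S" using assms by simp
  then have j: "j \<in> ?S" "l \<le> j" unfolding j_def
    by (rule Max_in[OF fin ex_in_conv[THEN iffD1], OF exI]) (rule Max_ge[OF fin \<open>l \<in> ?S\<close>])
  have up: "?H (Suc k) = ?H k + 1" using excess_take_Suc[OF assms(1), of a] assms(2) by simp
  have after: "?H i < ?H (Suc k)" if "j < i" "i \<le> k" for i
  proof (rule ccontr)
    assume "\<not> ?thesis"
    then have "i \<le> j" unfolding j_def using that by (intro Max_ge) auto
    then show False using that by simp
  qed
  have "j \<noteq> k" using j(1) up by auto
  then have "j < k" using j by simp
  then have "?H (Suc j) < ?H (Suc k)" using after[of "Suc j"] by simp
  moreover have "?H (Suc j) = ?H j + (if w ! j = a then 1 else if w ! j = Suc a then -1 else 0)"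
    using \<open>j < k\<close> assms(1) by (intro excess_take_Suc) simp
  ultimately have "w ! j = Suc a" "?H j = ?H (Suc k)" using j(1) by (auto split: if_splits)
  then have "excursion a w j k"
    unfolding excursion_def using \<open>j < k\<close> assms(1,2) after by simp
  then show ?thesis using j(2) by blast
qed

text \<open>Symmetrically, the partner of an opening bracket is found at the first return to its
  height.\<close>

lemma excursion_from:
  assumes "w ! l = Suc a" "l < i" "i \<le> length w" "excess a (take l w) \<le> excess a (take i w)"
  shows "\<exists>m. Suc m \<le> i \<and> excursion a w l m"
proof -
  let ?H = "\<lambda>i. excess a (take i w)"
  define k where "k = (LEAST k. l < k \<and> ?H l \<le> ?H k)"
  have k: "l < k" "?H l \<le> ?H k" and ki: "k \<le> i"
    using LeastI[of "\<lambda>k. l < k \<and> ?H l \<le> ?H k" i] Least_le[of "\<lambda>k. l < k \<and> ?H l \<le> ?H k" i] assms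
    by (auto simp: k_def)
  have before: "?H j < ?H l" if "l < j" "j < k" for j
    using not_less_Least[of j "\<lambda>k. l < k \<and> ?H l \<le> ?H k"] that by (auto simp: k_def)
  obtain m where m: "k = Suc m" using k(1) by (cases k) auto
  have "?H (Suc l) = ?H l - 1" using excess_take_Suc[of l w a] assms by simp
  then have "l < m" using k m by (cases "l = m") auto
  have "?H (Suc m) = ?H m + (if w ! m = a then 1 else if w ! m = Suc a then -1 else 0)"
    using m ki assms(3) by (intro excess_take_Suc) simp
  moreover have "?H m < ?H l" using before[of m] \<open>l < m\<close> m by simp
  ultimately have "w ! m = a" "?H (Suc m) = ?H l" using k(2) m by (auto split: if_splits)
  then have "excursion a w l m"
    unfolding excursion_def using \<open>l < m\<close> m ki assms before by auto
  then show ?thesis using m ki by auto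
qed

lemma bracketed_pair_iff: "bracketed_pair a w j k \<longleftrightarrow> excursion a w j k"
proof
  let ?H = "\<lambda>i. excess a (take i w)"
  show "bracketed_pair a w j k \<Longrightarrow> excursion a w j k"
  proof (induction rule: bracketed_pair.induct)
    case (1 j k)
    have inner: "\<exists>m. j < m \<and> m < k \<and> (excursion a w l m \<or> excursion a w m l)"
      if "j < l" "l < k" "w ! l = a \<or> w ! l = Suc a" for l
      using 1(5) that by force
    have st: "?H (Suc i) = ?H i + (if w ! i = a then 1 else if w ! i = Suc a then -1 else 0)"
      if "i \<le> k" for i using that 1(2) by (intro excess_take_Suc) simp
    \<comment> \<open>Read from the left, a closing bracket inside only returns to the height of its
      partner, so nothing exceeds the height after \<open>j\<close>. \<open>high\<close> is the same
      argument from the right, and together they equate the heights at \<open>Suc j\<close> and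
      \<open>k\<close>.\<close>
    have low: "j < i \<Longrightarrow> i \<le> k \<Longrightarrow> ?H i \<le> ?H (Suc j)" for i
    proof (induction i rule: less_induct)
      case (less i)
      show ?case
      proof (cases "i = Suc j")
        case False
        then obtain l where l: "i = Suc l" "j < l" "l < k" using less.prems by (cases i) auto
        show ?thesis
        proof (cases "w ! l = a")
          case True
          then obtain m where m: "j < m" "excursion a w l m \<or> excursion a w m l"
            using inner[of l] l by auto
          then have "excursion a w m l" using True by (auto simp: excursion_def)
          then have "?H i = ?H m" "m < l" using l by (auto simp: excursion_def)
          then show ?thesis using less.IH[of m] m l by simp
        next
          case False
          then have "?H i \<le> ?H l" using st[of l] l by auto
          then show ?thesis using less.IH[of l] l by simp
        qed
      qed simp
    qed
    have high: "?H i \<le> ?H k" if "j < i" "i \<le> k" for i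
      using that
    proof (induction "k - i" arbitrary: i rule: less_induct)
      case less
      show ?case
      proof (cases "i = k")
        case False
        then have "i < k" using less.prems by simp
        show ?thesis
        proof (cases "w ! i = Suc a")
          case True
          then obtain m where m: "m < k" "excursion a w i m \<or> excursion a w m i"
            using inner[of i] less.prems \<open>i < k\<close> by auto
          then have "excursion a w i m" using True by (auto simp: excursion_def)
          then have "?H i = ?H (Suc m)" "i < m" by (auto simp: excursion_def)
          then show ?thesis using less.hyps[of "Suc m"] m less.prems by simp
        next
          case False
          then have "?H i \<le> ?H (Suc i)" using st[of i] \<open>i < k\<close> by auto
          also have "\<dots> \<le> ?H k" using less.hyps[of "Suc i"] less.prems \<open>i < k\<close> by simp
          finally show ?thesis .
        qed
      qed simp
    qed
    have "?H k = ?H (Suc j)" using low[of k] high[of "Suc j"] 1(1) by simp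
    moreover have "?H (Suc j) = ?H j - 1" "?H (Suc k) = ?H k + 1" using st[of j] st[of k] 1 by auto
    moreover have "?H i < ?H j" if "j < i" "i \<le> k" for i
      using low[OF that] \<open>?H (Suc j) = ?H j - 1\<close> by simp
    ultimately show ?case using 1 by (simp add: excursion_def)
  qed
next
  let ?H = "\<lambda>i. excess a (take i w)"
  show "excursion a w j k \<Longrightarrow> bracketed_pair a w j k"
  proof (induction "k - j" arbitrary: j k rule: less_induct)
    case less
    note ex = less.prems[unfolded excursion_def]
    have "\<exists>m. j < m \<and> m < k \<and> (bracketed_pair a w l m \<or> bracketed_pair a w m l)"
      if l: "j < l" "l < k" "w ! l \<in> {a, a + 1}" for l
    proof (cases "w ! l = a")
      case True
      have "?H (Suc l) < ?H j" using ex l by simp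
      moreover have "?H (Suc j) = ?H j - 1" using excess_take_Suc[of j w a] ex by simp
      ultimately obtain m where m: "Suc j \<le> m" "excursion a w m l"
        using excursion_to[of l w a "Suc j"] True l ex by auto
      moreover have "l - m < k - j" using m(1) l by simp
      ultimately have "bracketed_pair a w m l" using less.hyps by blast
      then show ?thesis using m l by (auto simp: excursion_def)
    next
      case False
      then have "w ! l = Suc a" using l by simp
      moreover have "?H l < ?H j" using ex l by simp
      moreover have "?H (Suc k) = ?H k + 1" using excess_take_Suc[of k w a] ex by simp
      ultimately obtain m where m: "Suc m \<le> k" "excursion a w l m"
        using excursion_from[of w l a k] l ex by auto
      moreover have "m - l < k - j" using m(1) l by simp
      ultimately have "bracketed_pair a w l m" using less.hyps by blast
      then show ?thesis using m l by (auto simp: excursion_def)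
    qed
    then show ?case using ex by (intro bracketed_pair.intros) auto
  qed
qed

text \<open>An up step to a height attained before closes an excursion, so exactly the steps to a
  new record stay unmatched.\<close>

lemma unbracketed_iff:
  "k \<in> unbracketed a w a \<longleftrightarrow> k < length w \<and> w ! k = a \<and>
     (\<forall>i\<le>k. excess a (take i w) < excess a (take (Suc k) w))"
proof (cases "k < length w \<and> w ! k = a")
  case True
  have "\<not> bracketed_pair a w k l" for l using True by (simp add: bracketed_pair_iff excursion_def)
  moreover have "(\<exists>l. bracketed_pair a w l k) \<longleftrightarrow>
      (\<exists>i\<le>k. excess a (take (Suc k) w) \<le> excess a (take i w))"
  proof
    assume "\<exists>l. bracketed_pair a w l k"
    then show "\<exists>i\<le>k. excess a (take (Suc k) w) \<le> excess a (take i w)"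
      unfolding bracketed_pair_iff excursion_def by (metis order.order_iff_strict)
  next
    assume "\<exists>i\<le>k. excess a (take (Suc k) w) \<le> excess a (take i w)"
    then show "\<exists>l. bracketed_pair a w l k"
      unfolding bracketed_pair_iff using excursion_to True by blast
  qed
  ultimately show ?thesis using True by (auto simp: unbracketed_def not_le[symmetric])
qed (auto simp: unbracketed_def)

section \<open>Lowering operators on words\<close>

text \<open>The last record step is the first arrival at the global maximum.\<close>

lemma word_f_Some:
  assumes k: "k < length w"
    and before: "\<And>i. i \<le> k \<Longrightarrow> excess a (take i w) < excess a (take (Suc k) w)"
    and all: "\<And>i. excess a (take i w) \<le> excess a (take (Suc k) w)"
  shows "word_f a w = Some (w[k := a + 1])"
proof -
  have "w ! k = a" using before[of k] excess_take_Suc[OF k, of a] by (auto split: if_splits)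
  then have kU: "k \<in> unbracketed a w a" using k before unbracketed_iff by blast
  have "k' \<le> k" if "k' \<in> unbracketed a w a" for k'
  proof (rule ccontr)
    assume "\<not> ?thesis"
    then have "excess a (take (Suc k) w) < excess a (take (Suc k') w)"
      using that unfolding unbracketed_iff by simp
    then show False using all[of "Suc k'"] by simp
  qed
  moreover have "finite (unbracketed a w a)" by (rule finite_subset[of _ "{..<length w}"]) (auto simp: unbracketed_def)
  ultimately have "Max (unbracketed a w a) = k" using kU by (intro Max_eqI) auto
  then show ?thesis using kU by (auto simp: word_f_def Let_def)
qed

lemma word_f_None:
  assumes "\<And>i. excess a (take i w) \<le> 0"
  shows "word_f a w = None"
proof -
  have "k \<notin> unbracketed a w a" for k
    using assms[of "Suc k"] unbracketed_iff[of k a w] by force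
  then show ?thesis by (auto simp: word_f_def Let_def)
qed

text \<open>Inside a row the height exceeds its initial value by at most the number of letters
  \<open>a\<close>, so one bound per row suffices. The offset \<open>c\<close> carries the height of
  the rows already passed through the induction.\<close>

lemma excess_take_concat_le:
  assumes "c \<le> B" "\<And>x. x < length Rs \<Longrightarrow> c + excess a (concat (take x Rs)) + int (count_list (Rs ! x) a) \<le> B"
  shows "c + excess a (take i (concat Rs)) \<le> B"
  using assms
proof (induction Rs arbitrary: c i)
  case (Cons R Rs)
  have R: "c + int (count_list R a) \<le> B" using Cons.prems(2)[of 0] by simp
  have le: "excess a (take i R) \<le> int (count_list R a)" for i
  proof -
    have "count_list R a = count_list (take i R) a + count_list (drop i R) a"
      by (metis append_take_drop_id count_list_append)
    then show ?thesis by (simp add: excess_def)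
  qed
  show ?case
  proof (cases "i \<le> length R")
    case True
    then show ?thesis using le[of i] R by simp
  next
    case False
    have "(c + excess a R) + excess a (take (i - length R) (concat Rs)) \<le> B"
    proof (rule Cons.IH)
      show "c + excess a R \<le> B" using le[of "length R"] R by simp
      show "c + excess a R + excess a (concat (take x Rs)) + int (count_list (Rs ! x) a) \<le> B"
        if "x < length Rs" for x
        using Cons.prems(2)[of "Suc x"] that by (simp add: algebra_simps)
    qed
    then show ?thesis using False by (simp add: algebra_simps)
  qed
qed simp

section \<open>Tableaux as Gelfand--Tsetlin patterns\<close>

definition above :: "nat \<Rightarrow> nat list \<Rightarrow> nat" where
  "above a R = length (filter (\<lambda>y. a < y) R)"

text \<open>The Gelfand--Tsetlin pattern of a tableau, with rows counted from the bottom.\<close>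

definition gt :: "nat \<Rightarrow> nat list list \<Rightarrow> nat \<Rightarrow> nat \<Rightarrow> nat" where
  "gt r T = (\<lambda>a x. if x < r then above a (rev T ! x) else 0)"

lemma above_split: "above a R = count_list R (Suc a) + above (Suc a) R"
  by (induction R) (auto simp: above_def)

lemma count_list_above: "0 < a \<Longrightarrow> count_list R a + above a R = above (a - 1) R"
  using above_split[of "a - 1" R] by simp

lemma above_card: "above a R = card {j. j < length R \<and> a < R ! j}"
  by (simp add: above_def length_filter_conv_card)

lemma rows_unique:
  assumes "sorted R" "sorted R'" "length R = length R'" "\<And>a. above a R = above a R'"
  shows "R = R'"
proof -
  have "count_list R a = count_list R' a" for a
  proof (cases "a = 0")
    case True
    have "count_list R 0 + above 0 R = length R" for R
      by (induction R) (auto simp: above_def)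
    then show ?thesis using assms(3,4) True by (metis add_right_imp_eq)
  next
    case False
    then show ?thesis
      using count_list_above[of a R] count_list_above[of a R'] assms(4)[of a] assms(4)[of "a - 1"] by simp
  qed
  then have "mset R = mset R'" by (intro multiset_eqI) (simp add: count_mset)
  then show ?thesis using assms(1,2) by (metis properties_for_sort)
qed

lemma rect_tableaux_rows:
  "T \<in> rect_tableaux n r s \<longleftrightarrow> length (rev T) = r \<and>
     (\<forall>x<r. length (rev T ! x) = s \<and> sorted (rev T ! x) \<and> set (rev T ! x) \<subseteq> {1..n}) \<and>
     (\<forall>x j. Suc x < r \<and> j < s \<longrightarrow> rev T ! Suc x ! j < rev T ! x ! j)"
proof (cases "length T = r")
  case True
  have rows: "(\<forall>row\<in>set T. P row) \<longleftrightarrow> (\<forall>x<r. P (rev T ! x))" for P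
    using True by (metis in_set_conv_nth length_rev set_rev)
  have cols: "(\<forall>i j. i + 1 < r \<and> j < s \<longrightarrow> T ! i ! j < T ! (i + 1) ! j) \<longleftrightarrow>
      (\<forall>x j. Suc x < r \<and> j < s \<longrightarrow> rev T ! Suc x ! j < rev T ! x ! j)"
  proof safe
    fix x j assume *: "\<forall>i j. i + 1 < r \<and> j < s \<longrightarrow> T ! i ! j < T ! (i + 1) ! j" "Suc x < r" "j < s"
    have "rev T ! Suc x = T ! (r - Suc (Suc x))" "rev T ! x = T ! (r - Suc (Suc x) + 1)"
      using True *(2) by (auto simp: rev_nth Suc_diff_Suc)
    then show "rev T ! Suc x ! j < rev T ! x ! j" using * by simp
  next
    fix i j assume *: "\<forall>x j. Suc x < r \<and> j < s \<longrightarrow> rev T ! Suc x ! j < rev T ! x ! j" "i + 1 < r" "j < s"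
    have "rev T ! (r - Suc (Suc i)) = T ! (i + 1)" "rev T ! Suc (r - Suc (Suc i)) = T ! i"
      using True *(2) by (auto simp: rev_nth Suc_diff_Suc)
    then show "T ! i ! j < T ! (i + 1) ! j" using * by (metis Suc_diff_Suc Suc_eq_plus1 diff_less zero_less_Suc
      less_trans)
  qed
  show ?thesis unfolding rect_tableaux_def mem_Collect_eq rows cols using True by simp
qed (simp add: rect_tableaux_def)

lemma pattern_gt:
  assumes "T \<in> rect_tableaux n r s"
  shows "pattern n r s (gt r T)"
proof -
  have row: "length (rev T ! x) = s" "sorted (rev T ! x)" "set (rev T ! x) \<subseteq> {1..n}" if "x < r" for x
    using assms that unfolding rect_tableaux_rows by auto
  have col: "rev T ! Suc x ! j < rev T ! x ! j" if "Suc x < r" "j < s" for x j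
    using assms that unfolding rect_tableaux_rows by auto
  have "above 0 (rev T ! x) = s" if "x < r" for x
    using row[OF that] unfolding above_def by (subst filter_True) auto
  moreover have "above a (rev T ! x) = 0" if "x < r" "n \<le> a" for a x
    using row(3)[OF that(1)] that(2) by (auto simp: above_def filter_empty_conv)
  moreover have "above (Suc a) R \<le> above a R" for a R using above_split[of a R] by simp
  moreover have "above a (rev T ! Suc x) \<le> above (Suc a) (rev T ! x)" if "Suc x < r" for a x
    unfolding above_card
  proof (rule card_mono)
    show "{j. j < length (rev T ! Suc x) \<and> a < rev T ! Suc x ! j} \<subseteq>
        {j. j < length (rev T ! x) \<and> Suc a < rev T ! x ! j}"
      using row(1)[of x] row(1)[of "Suc x"] col that by fastforce
  qed simp
  ultimately show ?thesis by (auto simp: pattern_def gt_def)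
qed

lemma gt_inj:
  assumes "T \<in> rect_tableaux n r s" "T' \<in> rect_tableaux n r s" "gt r T = gt r T'"
  shows "T = T'"
proof -
  have "rev T = rev T'"
  proof (rule nth_equalityI)
    show "length (rev T) = length (rev T')" using assms by (simp add: rect_tableaux_rows)
    fix x assume "x < length (rev T)"
    then have x: "x < r" using assms(1) by (simp add: rect_tableaux_rows)
    show "rev T ! x = rev T' ! x"
    proof (rule rows_unique)
      show "above a (rev T ! x) = above a (rev T' ! x)" for a
        using x fun_cong[OF fun_cong[OF assms(3)], of a x] by (simp add: gt_def)
    qed (use assms x in \<open>auto simp: rect_tableaux_rows\<close>)
  qed
  then show ?thesis by simp
qed

lemma gt_surj:
  assumes g: "pattern n r s g"
  obtains T where "T \<in> rect_tableaux n r s" "gt r T = g"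
proof -
  \<comment> \<open>The cell in column \<open>j\<close> must exceed \<open>a\<close> exactly if it
    is among the last \<open>g a x\<close> cells of the row. These \<open>a\<close> form an initial
    segment of the naturals, so the letter of the cell is their number.\<close>
  define D where "D x j = {a. s \<le> j + g a x}" for x j
  have anti: "g b x \<le> g a x" if "a \<le> b" for a b x
    using lift_Suc_antimono_le[of "\<lambda>a. g a x" a b] pattern_node[OF g] that by blast
  have sub: "D x j \<subseteq> {..<n}" if "j < s" for x j
  proof
    fix a assume "a \<in> D x j"
    then have "g a x \<noteq> 0" using that by (auto simp: D_def)
    then show "a \<in> {..<n}" using pattern_zero[OF g, of a x] by (meson lessThan_iff not_less)
  qed
  have fin: "finite (D x j)" if "j < s" for x j using sub[OF that] by (rule finite_subset) simp
  have mem: "b < card (D x j) \<longleftrightarrow> b \<in> D x j" if "j < s" for x j b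
  proof
    assume "b \<in> D x j"
    have "{..b} \<subseteq> D x j"
    proof
      fix a assume "a \<in> {..b}"
      then show "a \<in> D x j" using anti[of a b x] \<open>b \<in> D x j\<close> by (simp add: D_def)
    qed
    then have "card {..b} \<le> card (D x j)" by (rule card_mono[OF fin[OF that]])
    then show "b < card (D x j)" by simp
  next
    assume "b < card (D x j)"
    show "b \<in> D x j"
    proof (rule ccontr)
      assume "b \<notin> D x j"
      have "D x j \<subseteq> {..<b}"
      proof
        fix a assume "a \<in> D x j"
        then have "\<not> b \<le> a" using anti[of b a x] \<open>b \<notin> D x j\<close> by (auto simp: D_def)
        then show "a \<in> {..<b}" by simp
      qed
      then have "card (D x j) \<le> card {..<b}" by (rule card_mono[rotated]) simp
      then show False using \<open>b < card (D x j)\<close> by simp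
    qed
  qed
  define Rs where "Rs = map (\<lambda>x. map (\<lambda>j. card (D x j)) [0..<s]) [0..<r]"
  have nth: "Rs ! x ! j = card (D x j)" if "x < r" "j < s" for x j using that by (simp add: Rs_def)
  have len: "length (Rs ! x) = s" if "x < r" for x using that by (simp add: Rs_def)
  have "rev Rs \<in> rect_tableaux n r s"
    unfolding rect_tableaux_rows rev_rev_ident
  proof (intro conjI allI impI)
    show "length Rs = r" by (simp add: Rs_def)
    fix x assume x: "x < r"
    show "length (Rs ! x) = s" using len[OF x] .
    show "sorted (Rs ! x)"
      unfolding sorted_iff_nth_mono len[OF x]
    proof (intro allI impI)
      fix i j assume ij: "i \<le> j" "j < s"
      then have "card (D x i) \<le> card (D x j)" using fin by (intro card_mono) (auto simp: D_def)
      then show "Rs ! x ! i \<le> Rs ! x ! j" using nth[OF x] ij by simp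
    qed
    show "set (Rs ! x) \<subseteq> {1..n}"
    proof
      fix y assume "y \<in> set (Rs ! x)"
      then obtain j where j: "j < s" "y = card (D x j)"
        using nth[OF x] by (auto simp: in_set_conv_nth len[OF x])
      have "0 \<in> D x j" using pattern_0[OF g x] by (simp add: D_def)
      then have "1 \<le> y" using mem[OF j(1), of 0 x] j(2) by simp
      moreover have "y \<le> n" using card_mono[OF _ sub[OF j(1), of x]] j(2) by simp
      ultimately show "y \<in> {1..n}" by simp
    qed
  next
    fix x j assume xj: "Suc x < r \<and> j < s"
    \<comment> \<open>\<open>Suc\<close> maps \<open>D (Suc x) j\<close> into \<open>D x j\<close>
      by the diagonal inequality, and 0 comes in addition: this is column strictness.\<close>
    have "insert 0 (Suc ` D (Suc x) j) \<subseteq> D x j"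
      using pattern_0[OF g, of x] pattern_diag[OF g, of _ x] xj
      by (auto simp: D_def) (meson add_left_mono order_trans)
    then have "card (insert 0 (Suc ` D (Suc x) j)) \<le> card (D x j)"
      using fin xj by (intro card_mono) auto
    also have "card (insert 0 (Suc ` D (Suc x) j)) = Suc (card (D (Suc x) j))"
      using fin xj by (subst card_insert_disjoint) (auto simp: card_image)
    finally show "Rs ! Suc x ! j < Rs ! x ! j" using nth xj by simp
  qed
  moreover have "gt r (rev Rs) = g"
  proof (intro ext)
    fix a x
    show "gt r (rev Rs) a x = g a x"
    proof (cases "x < r")
      case True
      have "{j. j < s \<and> a < Rs ! x ! j} = {s - g a x..<s}"
        using nth[OF True] mem by (auto simp: D_def)
      then show ?thesis
        using True len[OF True] pattern_le[OF g, of a x] by (simp add: gt_def above_card)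
    next
      case False
      then show ?thesis using pattern_zero[OF g] by (simp add: gt_def)
    qed
  qed
  ultimately show thesis using that by blast
qed

section \<open>Weights, row heights and lowering operators on tableaux\<close>

lemma count_gt:
  assumes "T \<in> rect_tableaux n r s" "0 < c"
  shows "int (count (mset (reading_word T)) c) = (\<Sum>x<r. int (gt r T (c - 1) x) - int (gt r T c x))"
proof -
  have "count (mset (concat Rs)) c = (\<Sum>x<length Rs. count_list (Rs ! x) c)" for Rs :: "nat list list"
    by (induction Rs rule: rev_induct) (auto simp: nth_append count_mset)
  moreover have "length (rev T) = r" using assms by (simp add: rect_tableaux_rows)
  ultimately have "int (count (mset (reading_word T)) c) = (\<Sum>x<r. int (count_list (rev T ! x) c))"
    by (simp add: reading_word_def)
  also have "\<dots> = (\<Sum>x<r. int (gt r T (c - 1) x) - int (gt r T c x))"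
  proof (rule sum.cong)
    fix x assume "x \<in> {..<r}"
    then show "int (count_list (rev T ! x) c) = int (gt r T (c - 1) x) - int (gt r T c x)"
      using count_list_above[OF assms(2), of "rev T ! x"] by (simp add: gt_def)
  qed simp
  finally show ?thesis .
qed

text \<open>The largest height reached by the path of the reading word in the \<open>x\<close>-th row from below.\<close>

definition row_height :: "nat \<Rightarrow> nat list list \<Rightarrow> nat \<Rightarrow> int" where
  "row_height a Rs x = excess a (concat (take x Rs)) + int (count_list (Rs ! x) a)"

text \<open>From one row to the next the height changes by the letters \<open>a\<close> of the new
  row minus the letters \<open>a + 1\<close> of the old one, opposite to the change of
  \<open>lab\<close>. So the first maximum of the path is the first minimum of the labels, which is
  how bracketing and riggings select the same row.\<close>

lemma row_height_lab:
  assumes T: "T \<in> rect_tableaux n r s" and a: "0 < a" and x: "x < r"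
  shows "row_height a (rev T) x + lab r (gt r T) a x =
    int (gt r T (a - 1) 0) - int (gt r T a 0) + lab r (gt r T) a 0"
  using x
proof (induction x)
  case 0
  then show ?case using count_list_above[OF a, of "rev T ! 0"] by (simp add: row_height_def gt_def)
next
  case (Suc x)
  have len: "length (rev T) = r" using T by (simp add: rect_tableaux_rows)
  have "excess a (concat (take (Suc x) (rev T))) =
      excess a (concat (take x (rev T))) + excess a (rev T ! x)"
    using Suc.prems len by (simp add: take_Suc_conv_app_nth del: rev_nth)
  moreover have "int (count_list (rev T ! Suc x) a) = int (gt r T (a - 1) (Suc x)) - int (gt r T a (Suc x))"
    using count_list_above[OF a, of "rev T ! Suc x"] Suc.prems by (simp add: gt_def)
  moreover have "int (count_list (rev T ! x) (Suc a)) = int (gt r T a x) - int (gt r T (Suc a) x)"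
    using above_split[of a "rev T ! x"] Suc.prems by (simp add: gt_def)
  ultimately have "row_height a (rev T) (Suc x) = row_height a (rev T) x
      + (int (gt r T (a - 1) (Suc x)) - int (gt r T a (Suc x))) - (int (gt r T a x) - int (gt r T (Suc a) x))"
    by (simp add: row_height_def excess_def)
  then show ?case using Suc lab_step[OF pattern_gt[OF T], of x a] by simp
qed

text \<open>For \<open>q > 0\<close> the strict drop of the label before \<open>q\<close> makes both
  sides true. Only the bottom row can fail, and there the height is its number of letters
  \<open>a\<close>.\<close>

lemma row_height_pos_iff:
  assumes T: "T \<in> rect_tableaux n r s" and a: "a \<in> {1..<n}" and q: "first_min r (gt r T) a q"
  shows "0 < row_height a (rev T) q \<longleftrightarrow> pattern n r s (bump (gt r T) a q)"
proof -
  let ?g = "gt r T"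
  note g = pattern_gt[OF T]
  have a0: "0 < a" "a < n" using a by auto
  have qr: "q < r" using q by (simp add: first_min_def)
  note rh = row_height_lab[OF T a0(1)]
  have rh0: "row_height a (rev T) 0 = int (?g (a - 1) 0) - int (?g a 0)" using rh[of 0] qr by simp
  show ?thesis
  proof (cases q)
    case 0
    then show ?thesis
      using rh0 pattern_bumpI[OF g a0, of 0] pattern_bumpD(1)[of n r s ?g a 0] a0 qr by auto
  next
    case (Suc x)
    have "lab r ?g a q < lab r ?g a 0" using q Suc by (simp add: first_min_def)
    then have pos: "0 < row_height a (rev T) q"
      using rh[OF qr] rh[of 0] rh0 qr pattern_node_pred[OF g, of a 0] by simp
    have "lab r ?g a q < lab r ?g a x" using q Suc by (simp add: first_min_def)
    then have lt: "?g a x + ?g a q < ?g (Suc a) x + ?g (a - 1) q"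
      using lab_step[OF g, of x a] qr Suc by simp
    have "pattern n r s (bump ?g a q)"
    proof (rule pattern_bumpI[OF g a0 qr])
      show "?g a q < ?g (a - 1) q" using lt pattern_node[OF g, of a x] by simp
      show "?g a q < ?g (Suc a) y" if "q = Suc y" for y
        using lt pattern_diag_pred[OF g a0(1), of x] that Suc by simp
    qed
    then show ?thesis using pos by simp
  qed
qed

lemma refill_eqI:
  assumes "map length T' = map length T" "reading_word T' = w"
  shows "refill T w = T'"
  unfolding refill_def
proof (rule the_equality)
  fix T'' assume T'': "map length T'' = map length T \<and> reading_word T'' = w"
  have len: "map length (rev T'') = map length (rev T')" using T'' assms(1) by (simp flip: rev_map)
  then have l: "length (rev T'') = length (rev T')" by (metis length_map)
  have "rev T'' = rev T'"
  proof (rule concat_injective[OF _ l])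
    show "concat (rev T'') = concat (rev T')" using T'' assms(2) by (simp add: reading_word_def)
    show "\<forall>(x, y)\<in>set (zip (rev T'') (rev T')). length x = length y"
    proof clarify
      fix x y assume "(x, y) \<in> set (zip (rev T'') (rev T'))"
      then obtain i where i: "i < length (rev T'')" "x = rev T'' ! i" "y = rev T' ! i"
        using l unfolding in_set_zip by auto
      have "map length (rev T'') ! i = map length (rev T') ! i" unfolding len ..
      then show "length x = length y" unfolding i(2,3) using i(1) l by (simp only: nth_map)
    qed
  qed
  then show "T'' = T'" by simp
qed (use assms in simp)

lemma KR_f_bump:
  assumes T: "T \<in> rect_tableaux n r s" and T': "T' \<in> rect_tableaux n r s" and a: "a \<in> {1..<n}"
    and q: "first_min r (gt r T) a q" and eq: "gt r T' = bump (gt r T) a q"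
  shows "f_op (KR_crystal n r s) a T = Some T'"
proof -
  let ?g = "gt r T"
  define Rs where "Rs = rev T"
  have gtR: "?g b x = above b (Rs ! x)" if "x < r" for b x using that by (simp add: gt_def Rs_def)
  define R where "R = Rs ! q"
  have g: "pattern n r s ?g" and g': "pattern n r s (bump ?g a q)"
    using pattern_gt[OF T] pattern_gt[OF T'] eq by auto
  have a0: "0 < a" using a by simp
  have qr: "q < r" using q by (simp add: first_min_def)
  have len: "length Rs = r" "length (rev T') = r" using T T' by (auto simp: rect_tableaux_rows Rs_def)
  have R: "sorted R" "length R = s" using T qr by (auto simp: rect_tableaux_rows R_def Rs_def)
  \<comment> \<open>The letters greater than \<open>a\<close> fill the last \<open>above a R\<close>
    cells, so \<open>p\<close> is the position of the last letter \<open>a\<close> in row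
    \<open>q\<close>.\<close>
  define p where "p = s - above a R - 1"
  have "above a R < above (a - 1) R"
    using pattern_bumpD(1)[OF g' a0] qr by (simp add: gtR R_def)
  have part: "a < R ! i \<longleftrightarrow> s - above a R \<le> i" if "i < s" for i a
  proof -
    have up: "a < R ! j" if "a < R ! i" "i \<le> j" "j < s" for i j
      using sorted_nth_mono[OF R(1) that(2)] R(2) that by force
    have ab: "above a R = card {j. j < s \<and> a < R ! j}" using above_card R(2) by simp
    show ?thesis
    proof
      assume "a < R ! i"
      then have "{i..<s} \<subseteq> {j. j < s \<and> a < R ! j}" using up by auto
      then have "card {i..<s} \<le> card {j. j < s \<and> a < R ! j}" by (rule card_mono[rotated]) simp
      then have "s - i \<le> above a R" unfolding ab by simp
      then show "s - above a R \<le> i" by simp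
    next
      assume le: "s - above a R \<le> i"
      show "a < R ! i"
      proof (rule ccontr)
        assume "\<not> ?thesis"
        have "{j. j < s \<and> a < R ! j} \<subseteq> {Suc i..<s}"
        proof
          fix j assume j: "j \<in> {j. j < s \<and> a < R ! j}"
          have "\<not> j \<le> i" using up[of j i] j \<open>\<not> a < R ! i\<close> \<open>i < s\<close> by auto
          then show "j \<in> {Suc i..<s}" using j by simp
        qed
        then have "card {j. j < s \<and> a < R ! j} \<le> card {Suc i..<s}" by (rule card_mono[rotated]) simp
        then have "above a R \<le> s - Suc i" unfolding ab by simp
        then show False using le that by simp
      qed
    qed
  qed
  have "above (a - 1) R \<le> s" using length_filter_le[of _ R] R(2) by (simp add: above_def)
  then have ps: "p < s" "above a R + Suc p = s"
    using \<open>above a R < above (a - 1) R\<close> by (auto simp: p_def)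
  have "\<not> a < R ! p" "a - 1 < R ! p"
    using part[of p a] part[of p "a - 1"] ps \<open>above a R < above (a - 1) R\<close> by auto
  then have Rp: "R ! p = a" using a0 by simp
  have beyond: "a < R ! i" if "p < i" "i < s" for i using part[of i a] ps that by simp
  define R' where "R' = R[p := Suc a]"
  have "sorted R'"
    unfolding sorted_iff_nth_mono
  proof (intro allI impI)
    fix i j assume ij: "i \<le> j" "j < length R'"
    then have "R ! i \<le> R ! j" using sorted_nth_mono[OF R(1)] by (simp add: R'_def)
    then show "R' ! i \<le> R' ! j"
      using ij Rp beyond[of j] R(2) by (cases "i = p"; cases "j = p") (auto simp: R'_def nth_list_update)
  qed
  have split: "R = take p R @ a # drop (Suc p) R" using id_take_nth_drop[of p R] Rp ps R(2) by simp
  have R'split: "R' = take p R @ Suc a # drop (Suc p) R"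
    unfolding R'_def using ps R(2) by (simp add: upd_conv_take_nth_drop)
  have ab': "above b R' = above b R + (if b = a then 1 else 0)" for b
    unfolding R'split by (subst (3) split) (auto simp: above_def)
  have rows: "rev T' = Rs[q := R']"
  proof (rule nth_equalityI)
    fix x assume "x < length (rev T')"
    then have x: "x < r" using len by simp
    have abx: "above b (rev T' ! x) = above b (Rs ! x) + (if b = a \<and> x = q then 1 else 0)" for b
      using fun_cong[OF fun_cong[OF eq], of b x] x gtR[OF x] by (auto simp: gt_def[of r T'] bump_def split: if_splits)
    have upd: "Rs[q := R'] ! x = (if x = q then R' else Rs ! x)"
      using len(1) qr by (auto simp: nth_list_update)
    have row: "sorted (Rs ! x)" "sorted (rev T' ! x)" "length (Rs ! x) = s" "length (rev T' ! x) = s"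
      using T T' x unfolding rect_tableaux_rows Rs_def by blast+
    show "rev T' ! x = Rs[q := R'] ! x"
      unfolding upd
    proof (rule rows_unique)
      show "sorted (if x = q then R' else Rs ! x)" using row(1) \<open>sorted R'\<close> by (cases "x = q") auto
      show "length (rev T' ! x) = length (if x = q then R' else Rs ! x)"
        using row(3,4) R(2) by (cases "x = q") (auto simp: R'_def)
      show "above b (rev T' ! x) = above b (if x = q then R' else Rs ! x)" for b
      proof (cases "x = q")
        case True
        then show ?thesis using abx[of b] ab'[of b] unfolding R_def by simp
      next
        case False
        then show ?thesis using abx[of b] by simp
      qed
    qed (rule row(2))
  qed (use len in simp)
  let ?w = "reading_word T" and ?u = "concat (take q Rs)"
  define k where "k = length ?u + p"
  have dec: "Rs = take q Rs @ R # drop (Suc q) Rs"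
    unfolding R_def using qr len by (intro id_take_nth_drop) simp
  have w: "?w = ?u @ take p R @ a # drop (Suc p) R @ concat (drop (Suc q) Rs)"
    unfolding reading_word_def Rs_def[symmetric] by (subst dec, subst split) simp
  have k: "k < length ?w" unfolding w k_def using ps R(2) by simp
  have tk: "take (Suc k) ?w = ?u @ take p R @ [a]"
    unfolding w k_def using ps R(2) by simp
  have noSuc: "count_list (take p R) (Suc a) = 0"
  proof -
    have "y \<noteq> Suc a" if "y \<in> set (take p R)" for y
    proof -
      obtain i where "i < p" "y = R ! i" using \<open>y \<in> set (take p R)\<close> by (auto simp: in_set_conv_nth)
      then show ?thesis using sorted_nth_mono[OF R(1), of i p] Rp ps R(2) by simp
    qed
    then show ?thesis by (auto simp: count_list_0_iff)
  qed
  have noa: "count_list (drop (Suc p) R) a = 0"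
  proof -
    have "y \<noteq> a" if "y \<in> set (drop (Suc p) R)" for y
    proof -
      obtain i where "i < length (drop (Suc p) R)" "y = drop (Suc p) R ! i"
        using \<open>y \<in> set (drop (Suc p) R)\<close> unfolding in_set_conv_nth by metis
      then have "Suc p + i < s" "y = R ! (Suc p + i)" using R(2) by auto
      then show ?thesis using beyond[of "Suc p + i"] by simp
    qed
    then show ?thesis by (auto simp: count_list_0_iff)
  qed
  have "count_list R a = count_list (take p R @ a # drop (Suc p) R) a"
    by (rule arg_cong[OF split, of "\<lambda>R. count_list R a"])
  then have cR: "count_list R a = Suc (count_list (take p R) a)" by (simp add: noa)
  have top: "excess a (take (Suc k) ?w) = row_height a Rs q"
    unfolding tk row_height_def R_def[symmetric] cR excess_append
    by (simp add: noSuc excess_def[of a "take p R"] excess_def[of a "[a]"])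
  have pos: "0 < row_height a Rs q" using row_height_pos_iff[OF T a q] g' by (simp add: Rs_def)
  note rh = row_height_lab[OF T a0, folded Rs_def]
  have le: "row_height a Rs x \<le> row_height a Rs q" if "x < r" for x
  proof -
    have "lab r ?g a q \<le> lab r ?g a x" using q that by (simp add: first_min_def)
    then show ?thesis using rh[OF that] rh[OF qr] by linarith
  qed
  have lt: "row_height a Rs x < row_height a Rs q" if "x < q" for x
  proof -
    have "lab r ?g a q < lab r ?g a x" using q that by (simp add: first_min_def)
    then show ?thesis using rh[of x] rh[OF qr] that qr by linarith
  qed
  have "word_f a ?w = Some (?w[k := a + 1])"
  proof (rule word_f_Some[OF k])
    show "excess a (take i ?w) \<le> excess a (take (Suc k) ?w)" for i
    proof -
      have "0 + excess a (take i (concat Rs)) \<le> row_height a Rs q"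
      proof (rule excess_take_concat_le)
        fix x assume "x < length Rs"
        then have "row_height a Rs x \<le> row_height a Rs q" using le len by simp
        then show "0 + excess a (concat (take x Rs)) + int (count_list (Rs ! x) a) \<le> row_height a Rs q"
          by (simp only: row_height_def)
      qed (use pos in simp)
      then show ?thesis unfolding top by (simp add: reading_word_def Rs_def)
    qed
    show "excess a (take i ?w) < excess a (take (Suc k) ?w)" if "i \<le> k" for i
    proof -
      \<comment> \<open>Up to position \<open>k\<close> the word consists of the rows before
        \<open>q\<close>, whose heights are strictly smaller, and of row \<open>q\<close> without
        its last letter \<open>a\<close>; in both cases one unit is missing from the
        maximum.\<close>
      let ?Qs = "take q Rs @ [take p R]"
      have "0 + excess a (take i (concat ?Qs)) \<le> row_height a Rs q - 1"
      proof (rule excess_take_concat_le)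
        fix x assume "x < length ?Qs"
        then have "x < q \<or> x = q" using len qr by auto
        then show "0 + excess a (concat (take x ?Qs)) + int (count_list (?Qs ! x) a) \<le> row_height a Rs q - 1"
        proof
          assume "x < q"
          then have "take x ?Qs = take x Rs" "?Qs ! x = Rs ! x" using len qr by (auto simp: nth_append)
          then show ?thesis using lt[OF \<open>x < q\<close>] by (simp add: row_height_def)
        next
          assume "x = q"
          then have "take x ?Qs = take q Rs" "?Qs ! x = take p R" using len qr by (auto simp: nth_append)
          then show ?thesis unfolding row_height_def R_def[symmetric] cR by simp
        qed
      qed (use pos in simp)
      moreover have "take i ?w = take i (concat ?Qs)"
        unfolding w using that ps R(2) by (simp add: k_def)
      ultimately show ?thesis unfolding top by simp
    qed
  qed
  moreover have "refill T (?w[k := a + 1]) = T'"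
  proof (rule refill_eqI)
    have rv: "T' = rev (Rs[q := R'])" unfolding rows[symmetric] by simp
    have "map length (Rs[q := R']) = map length Rs"
    proof -
      have "length R' = map length Rs ! q" using qr len by (simp add: R'_def R_def)
      then show ?thesis unfolding map_update by (simp only: list_update_id)
    qed
    then show "map length T' = map length T" unfolding rv by (simp add: Rs_def flip: rev_map)
    have "Rs[q := R'] = take q Rs @ R' # drop (Suc q) Rs"
      using qr len by (simp add: upd_conv_take_nth_drop)
    then have "reading_word T' = ?u @ take p R @ Suc a # drop (Suc p) R @ concat (drop (Suc q) Rs)"
      unfolding reading_word_def rows by (simp add: R'split)
    then show "reading_word T' = ?w[k := a + 1]"
      unfolding w k_def using ps R(2) by (simp add: list_update_append)
  qed
  ultimately show ?thesis by (simp add: KR_crystal_def)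
qed

lemma KR_f_cases:
  assumes T: "T \<in> rect_tableaux n r s" and r: "0 < r" and a: "a \<in> {1..<n}"
    and f: "f_op (KR_crystal n r s) a T = Some T'"
  shows "T' \<in> rect_tableaux n r s \<and>
    (\<exists>q. first_min r (gt r T) a q \<and> gt r T' = bump (gt r T) a q)"
proof -
  obtain q where q: "first_min r (gt r T) a q" using first_min_exists[OF r] .
  have qr: "q < r" using q by (simp add: first_min_def)
  have len: "length (rev T) = r" using T by (simp add: rect_tableaux_rows)
  \<comment> \<open>Otherwise no prefix of the reading word rises above height 0, and
    \<open>f_a\<close> would be undefined.\<close>
  have "0 < row_height a (rev T) q"
  proof (rule ccontr)
    assume np: "\<not> ?thesis"
    have "0 + excess a (take i (concat (rev T))) \<le> 0" for i
    proof (rule excess_take_concat_le)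
      fix x assume "x < length (rev T)"
      then have x: "x < r" using len by simp
      have "lab r (gt r T) a q \<le> lab r (gt r T) a x" using q x by (simp add: first_min_def)
      then have "row_height a (rev T) x \<le> row_height a (rev T) q"
        using row_height_lab[OF T _ x, of a] row_height_lab[OF T _ qr, of a] a
        by simp
      then show "0 + excess a (concat (take x (rev T))) + int (count_list (rev T ! x) a) \<le> 0"
        using np by (simp add: row_height_def)
    qed simp
    then have "word_f a (reading_word T) = None"
      by (intro word_f_None) (simp add: reading_word_def)
    then show False using f by (simp add: KR_crystal_def)
  qed
  then have "pattern n r s (bump (gt r T) a q)" using row_height_pos_iff[OF T a q] by simp
  then obtain T'' where T'': "T'' \<in> rect_tableaux n r s" "gt r T'' = bump (gt r T) a q"
    by (rule gt_surj)
  then have "T'' = T'" using KR_f_bump[OF T T''(1) a q T''(2)] f by simp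
  then show ?thesis using T'' q by blast
qed

section \<open>Promotion\<close>

lemma KR_predecessor:
  assumes T: "T \<in> rect_tableaux n r s" and a: "a \<in> {1..<n}" and x: "x < r" "lab r (gt r T) a x < 0"
  obtains T' q where "T' \<in> rect_tableaux n r s" "first_min r (gt r T') a q"
    "gt r T = bump (gt r T') a q" "f_op (KR_crystal n r s) a T' = Some T"
proof -
  obtain g q where g: "pattern n r s g" "first_min r g a q" "gt r T = bump g a q"
    using bump_predecessor[OF pattern_gt[OF T] a x] .
  obtain T' where "T' \<in> rect_tableaux n r s" "gt r T' = g" using gt_surj[OF g(1)] .
  then show thesis using that g KR_f_bump[OF _ T a, of T' q] by simp
qed

text \<open>Undoing some \<open>f_a\<close> lowers the sum of the pattern entries, so it ends at a
  tableau of highest weight for \<open>J\<close>. All nodes are taken for \<open>\<Psi>\<close>, all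
  but the last for promotion.\<close>

lemma KR_induct [consumes 2, case_names highest step]:
  assumes T: "T \<in> rect_tableaux n r s" and J: "J \<subseteq> {1..<n}"
    and hw: "\<And>T. T \<in> rect_tableaux n r s \<Longrightarrow> (\<And>a x. a \<in> J \<Longrightarrow> x < r \<Longrightarrow> 0 \<le> lab r (gt r T) a x) \<Longrightarrow> P T"
    and step: "\<And>T T' a. T \<in> rect_tableaux n r s \<Longrightarrow> T' \<in> rect_tableaux n r s \<Longrightarrow> a \<in> J \<Longrightarrow>
      f_op (KR_crystal n r s) a T = Some T' \<Longrightarrow> P T \<Longrightarrow> P T'"
  shows "P T"
  using T
proof (induction "\<Sum>a<n. \<Sum>x<r. gt r T a x" arbitrary: T rule: less_induct)
  case less
  show ?case
  proof (cases "\<forall>a\<in>J. \<forall>x<r. 0 \<le> lab r (gt r T) a x")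
    case True
    then show ?thesis using hw[OF less.prems] by blast
  next
    case False
    then obtain a x where a: "a \<in> J" "x < r" "lab r (gt r T) a x < 0" by (auto simp: not_le)
    then have an: "a \<in> {1..<n}" using J by blast
    obtain T' q where T': "T' \<in> rect_tableaux n r s" "first_min r (gt r T') a q"
      "gt r T = bump (gt r T') a q" "f_op (KR_crystal n r s) a T' = Some T"
      using KR_predecessor[OF less.prems an a(2,3)] .
    have q: "q < r" using T'(2) by (simp add: first_min_def)
    have "(\<Sum>x<r. gt r T' b x) \<le> (\<Sum>x<r. gt r T b x)" for b
      unfolding T'(3) by (intro sum_mono) (simp add: bump_def)
    moreover have "(\<Sum>x<r. gt r T' a x) < (\<Sum>x<r. gt r T a x)"
      unfolding T'(3) using q by (intro sum_strict_mono_ex1) (auto simp: bump_def)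
    ultimately have "(\<Sum>b<n. \<Sum>x<r. gt r T' b x) < (\<Sum>b<n. \<Sum>x<r. gt r T b x)"
      using an by (intro sum_strict_mono_ex1) auto
    then show ?thesis using step[OF T'(1) less.prems a(1) T'(4)] less.hyps[OF _ T'(1)] by simp
  qed
qed

section \<open>The isomorphism on tableaux\<close>

lemma L_weight_KR: "1 \<le> r \<Longrightarrow> r < n \<Longrightarrow> 1 \<le> s \<Longrightarrow> L_weight n (KR_mult r s) c = int s * fund_weight r c"
proof -
  assume "1 \<le> r" "r < n" "1 \<le> s"
  then have "{(a, i). (a, i) \<in> H_index n \<and> KR_mult r s a i \<noteq> 0} = {(r, s)}"
    by (auto simp: H_index_def KR_mult_def)
  then show ?thesis by (simp add: L_weight_def KR_mult_def)
qed

lemma empty_in_RC: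
  assumes "1 \<le> r" "r < n" "1 \<le> s"
  shows "(\<lambda>_. {#}) \<in> RC n (KR_mult r s)"
proof -
  let ?L = "KR_mult r s" and ?\<Lambda> = "L_weight n (KR_mult r s)"
  have shp: "shape (\<lambda>_. {#}) = (\<lambda>_. {#})" by (simp add: shape_def)
  have "is_configuration n ?L ?\<Lambda> (\<lambda>_. {#})"
    by (simp add: is_configuration_def config_weight_def)
  moreover have "admissible n ?L (\<lambda>_. {#})"
    by (auto simp: admissible_def vacancy_def intro!: sum_nonneg)
  moreover have "dominant n ?\<Lambda>"
    using L_weight_KR[OF assms] by (auto simp: dominant_def coroot_pairing_def fund_weight_def)
  ultimately have "(\<lambda>_. {#}) \<in> RC_bar n ?L" by (auto simp: RC_bar_def RC_bar_wt_def shp)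
  then show ?thesis by (rule RC.base)
qed

lemma RC_f_nonempty: "RC_f n L a R = Some R' \<Longrightarrow> R' a \<noteq> {#}"
  by (auto simp: RC_f_def replace_strings_def Let_def split: if_splits)

text \<open>No \<open>f_a\<close> produces the empty configuration, so its preimage under
  \<open>\<Psi>\<close> is of highest weight and hence is the unique such tableau. From there both
  sides follow the same operators.\<close>

lemma iso_singular_rc:
  assumes r: "1 \<le> r" "r < n" and s: "1 \<le> s"
    and iso: "classical_crystal_iso n (KR_crystal n r s) (RC_crystal n (KR_mult r s)) \<Psi>"
    and T: "T \<in> rect_tableaux n r s"
  shows "\<Psi> T = singular_rc n r (gt r T)"
proof -
  have f: "RC_f n (KR_mult r s) a (\<Psi> T) = map_option \<Psi> (f_op (KR_crystal n r s) a T)"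
    if "T \<in> rect_tableaux n r s" "a \<in> {1..<n}" for T a
    using iso that by (simp add: classical_crystal_iso_def KR_crystal_def RC_crystal_def)
  have "bij_betw \<Psi> (rect_tableaux n r s) (RC n (KR_mult r s))"
    using iso by (simp add: classical_crystal_iso_def KR_crystal_def RC_crystal_def)
  then obtain T0 where T0: "T0 \<in> rect_tableaux n r s" "\<Psi> T0 = (\<lambda>_. {#})"
    using empty_in_RC[OF r s] by (metis bij_betw_imp_surj_on imageE)
  have hw0: "0 \<le> lab r (gt r T0) a x" if a: "a \<in> {1..<n}" and x: "x < r" for a x
  proof (rule ccontr)
    assume "\<not> ?thesis"
    then obtain T' q where "T' \<in> rect_tableaux n r s" "f_op (KR_crystal n r s) a T' = Some T0"
      using KR_predecessor[OF T0(1) a x] by force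
    then show False using f[of T' a] a RC_f_nonempty[of n "KR_mult r s" a "\<Psi> T'" "\<Psi> T0"] T0(2) by simp
  qed
  have hwp: "gt r T = (\<lambda>a x. if r \<le> x then 0 else if a + x < r then s else 0)"
    if T: "T \<in> rect_tableaux n r s" and hw: "\<And>a x. a \<in> {1..<n} \<Longrightarrow> x < r \<Longrightarrow> 0 \<le> lab r (gt r T) a x" for T
  proof -
    have "gt r T n 0 = 0" using pattern_zero[OF pattern_gt[OF T]] by simp
    then show ?thesis
      using highest_weight_pattern[OF pattern_gt[OF T] r _ _ _ hw, of n] r by (simp cong: if_cong)
  qed
  from T order_refl show ?thesis
  proof (induction rule: KR_induct[where J = "{1..<n}"])
    case (highest T)
    then have "T = T0" using gt_inj[OF highest(1) T0(1)] hwp[OF highest] hwp[OF T0(1) hw0] by simp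
    moreover have zero: "gt r T a x = 0" if "r \<le> a + x" for a x
      using hwp[OF highest] that by simp
    have "parts r (gt r T) a = {#}" for a
    proof (rule ccontr)
      assume "parts r (gt r T) a \<noteq> {#}"
      then obtain i where "i \<in># parts r (gt r T) a" by (rule multiset_nonemptyE)
      then show False using zero by (auto simp: in_parts)
    qed
    ultimately show ?case using T0(2) by (auto simp: singular_rc_def)
  next
    case (step T T' a)
    obtain q where q: "first_min r (gt r T) a q" "gt r T' = bump (gt r T) a q"
      using KR_f_cases[OF step(1) _ step(3,4)] r by auto
    have "pattern n r s (bump (gt r T) a q)" using pattern_gt[OF step(2)] q(2) by simp
    then have "RC_f n (KR_mult r s) a (\<Psi> T) = Some (singular_rc n r (gt r T'))"
      using RC_f_singular_rc[OF pattern_gt[OF step(1)] r step(3) q(1)] step(5) q(2) by simp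
    then show ?case using f[OF step(1,3)] step(4) by simp
  qed
qed

section \<open>Promotion as a sequence of slides\<close>

lemma singular_rc_Suc:
  assumes "pattern n r s g"
  shows "singular_rc (Suc n) r g = singular_rc n r g" "singular_rc n r g n = {#}"
proof -
  have "parts r g n = {#}"
  proof -
    have "g n = (\<lambda>_. 0)" using pattern_zero[OF assms] by auto
    then show ?thesis by (simp add: parts_def filter_mset_eq_conv)
  qed
  then show "singular_rc (Suc n) r g = singular_rc n r g"
    by (auto simp: singular_rc_def fun_eq_iff less_Suc_eq)
  show "singular_rc n r g n = {#}" by (simp add: singular_rc_def)
qed

lemma pattern_shift: "pattern n r s g \<Longrightarrow> pattern (Suc n) r s (\<lambda>a. g (a - 1))"
proof -
  assume g: "pattern n r s g"
  have "g (Suc a - 1) x \<le> g (a - 1) x" for a x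
    using pattern_node_pred[OF g, of a x] by simp
  moreover have "g (a - 1) (Suc x) \<le> g (Suc a - 1) x" for a x
    using pattern_diag_pred[OF g, of a x] pattern_row[OF g, of 0 x] by (cases a) auto
  moreover have "g (a - 1) x = 0" if "Suc n \<le> a \<or> r \<le> x" for a x
    using that pattern_zero[OF g, of "a - 1" x] by (cases a) auto
  ultimately show ?thesis using pattern_0[OF g] by (auto simp: pattern_def)
qed

lemma sum_last_node:
  assumes g: "pattern n r s g" and "0 < r" "0 < n"
  shows "(\<Sum>x<r. int (g (n - 1) x)) = int (g (n - 1) 0)"
proof -
  have "(\<Sum>x<r. int (g (n - 1) x)) = (\<Sum>x<r. if x = 0 then int (g (n - 1) 0) else 0)"
    using pattern_empty[OF g, of "n - 1"] assms(3) by (intro sum.cong) auto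
  then show ?thesis using assms(2) by simp
qed

lemma promotion_slides:
  assumes r: "1 \<le> r" "r < n" and p: "promotion_operator n (KR_crystal n r s) p"
    and T: "T \<in> rect_tableaux n r s"
  shows "slides r n (gt r T (n - 1) 0) (\<lambda>a. gt r T (a - 1)) (gt r (p T))"
proof -
  let ?B = "KR_crystal n r s" and ?S = "rect_tableaux n r s"
  have elems: "elems ?B = ?S" by (simp add: KR_crystal_def)
  have bij: "bij_betw p ?S ?S" using p by (simp add: promotion_operator_def elems)
  have prom: "map_option p (affine_f ?B p a T) = affine_f ?B p ((a + 1) mod n) (p T)"
    "coroot_pairing n ((a + 1) mod n) (cwt ?B (p T)) = coroot_pairing n a (cwt ?B T)"
    if "T \<in> ?S" "a < n" for T a
    using p that unfolding promotion_operator_def elems by (auto simp del: add_Suc_right)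
  have pS: "p T \<in> ?S" if "T \<in> ?S" for T using bij that by (auto simp: bij_betw_def)
  have pf: "map_option p (f_op ?B a T) = f_op ?B (Suc a) (p T)" if "T \<in> ?S" "a \<in> {1..<n - 1}" for T a
  proof -
    have "map_option p (affine_f ?B p a T) = affine_f ?B p ((a + 1) mod n) (p T)"
      using that by (intro prom(1)) auto
    moreover have "Suc a < n" using that by auto
    ultimately show ?thesis using that by (simp add: affine_f_def)
  qed
  have J: "{1..<n - 1} \<subseteq> {1..<n}" by auto
  from T J show ?thesis
  proof (induction rule: KR_induct[where J = "{1..<n - 1}"])
    case (highest T)
    define k c where "k = gt r T (n - 1) 0" and "c = gt r (p T) 1 (r - 1)"
    have gT: "gt r T = (\<lambda>a x. if r \<le> x then 0 else if a + x < r then s else if x = 0 \<and> a < n then k else 0)"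
      unfolding k_def using r highest(2)
      by (intro highest_weight_pattern[OF pattern_gt[OF highest(1)] r]) auto
    \<comment> \<open>A negative label would make \<open>p T\<close> an image under
      \<open>f_a\<close>. Pulled back through \<open>p\<close>, this makes \<open>T\<close> an image
      under \<open>f\<close> at node \<open>a - 1\<close>, against its highest weight.\<close>
    have hw: "0 \<le> lab r (gt r (p T)) a x" if a: "a \<in> {2..<n}" and x: "x < r" for a x
    proof (rule ccontr)
      assume neg: "\<not> ?thesis"
      have an: "a \<in> {1..<n}" "a - 1 \<in> {1..<n - 1}" "a - 1 \<in> {1..<n}" "Suc (a - 1) = a" using a by auto
      obtain U where U: "U \<in> ?S" "f_op ?B a U = Some (p T)"
        using KR_predecessor[OF pS[OF highest(1)] an(1) x] neg by force
      have "U \<in> p ` ?S" using U(1) bij_betw_imp_surj_on[OF bij] by simp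
      then obtain V where V: "V \<in> ?S" "p V = U" by blast
      have "map_option p (f_op ?B (a - 1) V) = Some (p T)" using pf[OF V(1) an(2)] V U an(4) by simp
      then obtain W where W: "f_op ?B (a - 1) V = Some W" "p W = p T" by auto
      then obtain q where q: "W \<in> ?S" "first_min r (gt r V) (a - 1) q" "gt r W = bump (gt r V) (a - 1) q"
        using KR_f_cases[OF V(1) _ an(3) W(1)] r by auto
      have "W = T" by (rule inj_onD[OF bij_betw_imp_inj_on[OF bij] W(2) q(1) highest(1)])
      have qr: "q < r" using q(2) by (simp add: first_min_def)
      have "lab r (gt r T) (a - 1) q < 0"
        using lab_bump[OF qr, of "a - 1" "gt r V" q] an first_min_nonpos[OF pattern_gt[OF V(1)] q(2)]
          q(3) \<open>W = T\<close> by simp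
      then show False using highest(2)[OF an(2) qr] by simp
    qed
    have gp: "gt r (p T) = (\<lambda>a x. if r \<le> x then 0 else if a + x < r then s else if a + x = r then c else 0)"
      unfolding c_def by (rule shifted_highest_weight_pattern[OF pattern_gt[OF pS[OF highest(1)]] r hw])
    \<comment> \<open>The weight condition at node 0 is the relation that ties \<open>c\<close> to
      \<open>k\<close>.\<close>
    have pair: "cwt ?B (p T) 1 - cwt ?B (p T) 2 = cwt ?B T n - cwt ?B T 1"
      using prom(2)[OF highest(1), of 0] r by (simp add: coroot_pairing_def numeral_2_eq_2)
    have wt: "cwt ?B U c = (\<Sum>x<r. int (gt r U (c - 1) x)) - (\<Sum>x<r. int (gt r U c x))"
      if "U \<in> ?S" "0 < c" for U c
      using count_gt[OF that] by (simp add: KR_crystal_def sum_subtractf)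
    have "c + k = s"
    \<comment> \<open>A single row is special: there the letters 1 of \<open>T\<close> number
      \<open>s - k\<close> and the letters 2 of the image \<open>c\<close>, whereas for larger
      \<open>r\<close> both numbers are \<open>s\<close>.\<close>
    proof (cases "r = 1")
      case True
      have "gt r (p T) 0 0 = s" "gt r (p T) 2 0 = 0" "gt r T 0 0 = s" "gt r T n 0 = 0" "gt r T 1 0 = k"
        unfolding gp gT using True r by auto
      moreover have "gt r (p T) 1 0 = c" "gt r T (n - 1) 0 = k" using True by (simp_all add: c_def k_def)
      ultimately show ?thesis
        using pair wt[OF highest(1), of n] wt[OF highest(1), of 1]
          wt[OF pS[OF highest(1)], of 1] wt[OF pS[OF highest(1)], of 2] True r
        by simp
    next
      case False
      define m where "m = r - 2"
      have m: "r = Suc (Suc m)" using r False unfolding m_def by linarith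
      have S: "(\<Sum>x<r. int (gt r T 0 x)) = int r * int s" "(\<Sum>x<r. int (gt r T 1 x)) = int (Suc m) * int s"
        "(\<Sum>x<r. int (gt r T (n - 1) x)) = int k" "(\<Sum>x<r. int (gt r T n x)) = 0"
        "(\<Sum>x<r. int (gt r (p T) 0 x)) = int r * int s"
        "(\<Sum>x<r. int (gt r (p T) 1 x)) = int (Suc m) * int s + int c"
        "(\<Sum>x<r. int (gt r (p T) 2 x)) = int m * int s + int c"
      proof -
        have dec: "(\<Sum>x<r. f x) = (\<Sum>x<m. f x) + f m + f (Suc m)" for f :: "nat \<Rightarrow> int"
          unfolding m by simp
        have init: "(\<Sum>x<m. int (gt r U a x)) = int m * int s" if "U \<in> ?S" "a \<le> 2" for U a
        proof -
          have "(\<Sum>x<m. int (gt r U a x)) = (\<Sum>x<m. int s)"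
            using pattern_full[OF pattern_gt[OF that(1)]] that(2) m by (intro sum.cong) auto
          then show ?thesis by simp
        qed
        have T: "gt r T 0 m = s" "gt r T 0 (Suc m) = s" "gt r T 1 m = s" "gt r T 1 (Suc m) = 0"
          unfolding gT using m by auto
        have P: "gt r (p T) 0 m = s" "gt r (p T) 0 (Suc m) = s" "gt r (p T) 1 m = s"
          "gt r (p T) 1 (Suc m) = c" "gt r (p T) 2 m = c" "gt r (p T) 2 (Suc m) = 0"
          unfolding gp using m by auto
        have le: "(0::nat) \<le> 2" "(1::nat) \<le> 2" "(2::nat) \<le> 2" by auto
        show "(\<Sum>x<r. int (gt r T 0 x)) = int r * int s"
          unfolding dec T init[OF highest(1) le(1)] by (simp add: m algebra_simps)
        show "(\<Sum>x<r. int (gt r T 1 x)) = int (Suc m) * int s"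
          unfolding dec T init[OF highest(1) le(2)] by (simp add: algebra_simps)
        show "(\<Sum>x<r. int (gt r (p T) 0 x)) = int r * int s"
          unfolding dec P init[OF pS[OF highest(1)] le(1)] by (simp add: m algebra_simps)
        show "(\<Sum>x<r. int (gt r (p T) 1 x)) = int (Suc m) * int s + int c"
          unfolding dec P init[OF pS[OF highest(1)] le(2)] by (simp add: algebra_simps)
        show "(\<Sum>x<r. int (gt r (p T) 2 x)) = int m * int s + int c"
          unfolding dec P init[OF pS[OF highest(1)] le(3)] by simp
        show "(\<Sum>x<r. int (gt r T (n - 1) x)) = int k"
          unfolding k_def
          by (rule sum_last_node[OF pattern_gt[OF highest(1)]]) (use r in auto)
        show "(\<Sum>x<r. int (gt r T n x)) = 0"
          using pattern_zero[OF pattern_gt[OF highest(1)]] by simp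
      qed
      have "cwt ?B T n = int k" using wt[OF highest(1), of n] S(3,4) r by simp
      moreover have "cwt ?B T 1 = int r * int s - int (Suc m) * int s"
        using wt[OF highest(1), of 1] S(1,2) by simp
      moreover have "cwt ?B (p T) 1 = int r * int s - (int (Suc m) * int s + int c)"
        using wt[OF pS[OF highest(1)], of 1] S(5,6) by simp
      moreover have "cwt ?B (p T) 2 = int (Suc m) * int s - int m * int s"
        using wt[OF pS[OF highest(1)], of 2] S(6,7) by simp
      moreover have "int r * int s = int m * int s + 2 * int s" "int (Suc m) * int s = int m * int s + int s"
        by (auto simp: m algebra_simps)
      ultimately show ?thesis using pair by linarith
    qed
    then have ck: "c = s - k" "k \<le> s" by auto
    have "slides r n k (\<lambda>a x. if r \<le> x then 0 else if a - 1 + x < r then s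
        else if x = 0 \<and> a - 1 < n then k else 0) (gt r (p T))"
      unfolding gp ck(1) by (rule slides_highest_weight[OF r ck(2)])
    moreover have "(\<lambda>a. gt r T (a - 1)) = (\<lambda>a x. if r \<le> x then 0 else if a - 1 + x < r then s
        else if x = 0 \<and> a - 1 < n then k else 0)"
      unfolding gT by (rule refl)
    ultimately show ?case unfolding k_def[symmetric] by (simp only:)
  next
    case (step T T' a)
    have a: "a \<in> {1..<n}" "Suc a \<in> {1..<n}" using step(3) by auto
    let ?g = "\<lambda>b. gt r T (b - 1)"
    obtain q where q: "first_min r (gt r T) a q" "gt r T' = bump (gt r T) a q"
      using KR_f_cases[OF step(1) _ a(1) step(4)] r by auto
    have "f_op ?B (Suc a) (p T) = Some (p T')" using pf[OF step(1,3)] step(4) by simp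
    then obtain q2 where q2: "first_min r (gt r (p T)) (Suc a) q2"
        "gt r (p T') = bump (gt r (p T)) (Suc a) q2"
      using KR_f_cases[OF pS[OF step(1)] _ a(2)] r by auto
    have lab: "lab r ?g (Suc a) x = lab r (gt r T) a x" for x by (rule lab_cong) auto
    have bump: "bump ?g (Suc a) q = (\<lambda>b. gt r T' (b - 1))"
      unfolding q(2) using step(3) by (auto simp: bump_def fun_eq_iff)
    have "\<exists>q'. first_min r (gt r (p T)) (Suc a) q' \<and>
        slides r n (gt r T (n - 1) 0) (bump ?g (Suc a) q) (bump (gt r (p T)) (Suc a) q')"
    proof (rule slides_bump[OF _ step(5)])
      show "pattern (Suc n) r s ?g" by (rule pattern_shift[OF pattern_gt[OF step(1)]])
      show "2 \<le> Suc a" "Suc a < n" using step(3) by auto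
      show "first_min r ?g (Suc a) q" using q(1) unfolding first_min_def lab .
      show "pattern (Suc n) r s (bump ?g (Suc a) q)"
        unfolding bump by (rule pattern_shift[OF pattern_gt[OF step(2)]])
    qed
    then obtain q' where q': "first_min r (gt r (p T)) (Suc a) q'"
      "slides r n (gt r T (n - 1) 0) (bump ?g (Suc a) q) (bump (gt r (p T)) (Suc a) q')" by blast
    \<comment> \<open>The operator does not touch the letters \<open>n\<close>, so the number of
      slides is the same for \<open>T\<close> and \<open>T'\<close>.\<close>
    have "n - 1 \<noteq> a" using step(3) by auto
    then have k: "gt r T' (n - 1) 0 = gt r T (n - 1) 0" unfolding q(2) by (simp add: bump_def)
    \<comment> \<open>One row comes from transporting \<open>f_a\<close> through the slides, the
      other from the defining property of promotion; both are first minima of the same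
      pattern.\<close>
    have "q' = q2" by (rule first_min_unique[OF q'(1) q2(1)])
    then show ?case using q'(2) unfolding bump k q2(2) by simp
  qed
qed

theorem theorem4p11:
  fixes n r s :: nat
    and \<Psi> :: "nat list list \<Rightarrow> rigged_config"
    and pr\<^sub>B :: "nat list list \<Rightarrow> nat list list"
  assumes "1 \<le> r" and "r \<le> n - 1" and "1 \<le> s"
    and "classical_crystal_iso n (KR_crystal n r s) (RC_crystal n (KR_mult r s)) \<Psi>"
    and "promotion_operator n (KR_crystal n r s) pr\<^sub>B"
  shows "(\<forall>R\<in>RC n (KR_mult r s). \<exists>R'\<in>RC n (KR_mult r s). RC_pr n (KR_mult r s) R = Some R') \<and>
         (\<forall>b\<in>elems (KR_crystal n r s). RC_pr n (KR_mult r s) (\<Psi> b) = Some (\<Psi> (pr\<^sub>B b)))"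
proof -
  let ?L = "KR_mult r s" and ?S = "rect_tableaux n r s"
  have r: "1 \<le> r" "r < n" "r \<le> n" using assms(1,2) by auto
  have bij: "bij_betw \<Psi> ?S (RC n ?L)"
    using assms(4) by (simp add: classical_crystal_iso_def KR_crystal_def RC_crystal_def)
  have "bij_betw pr\<^sub>B ?S ?S" using assms(5) by (simp add: promotion_operator_def KR_crystal_def)
  then have prS: "pr\<^sub>B T \<in> ?S" if "T \<in> ?S" for T using that by (auto simp: bij_betw_def)
  have main: "RC_pr n ?L (\<Psi> T) = Some (\<Psi> (pr\<^sub>B T))" if T: "T \<in> ?S" for T
  proof -
    let ?g = "gt r T" and ?h = "gt r (pr\<^sub>B T)" and ?v = "RC_weight n ?L (\<Psi> T)"
    note g = pattern_gt[OF T] and h = pattern_gt[OF prS[OF T]]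
    note psi = iso_singular_rc[OF r(1,2) assms(3,4)]
    \<comment> \<open>Since \<open>r < n\<close>, the array already vanishes at the additional
      node.\<close>
    have L: "?L(n := (\<lambda>_. 0)) = ?L" using r by (auto simp: KR_mult_def fun_eq_iff)
    have R: "(\<Psi> T)(n := {#}) = singular_rc (Suc n) r ?g"
      unfolding psi[OF T] singular_rc_Suc(1)[OF g]
      using singular_rc_Suc(2)[OF g] by (intro fun_upd_idem) simp
    have v: "?v c = (\<Sum>x<r. int (?g (c - 1) x) - int (?g c x))" if "c \<in> {1..n}" for c
    proof -
      have "?v c = int (count (mset (reading_word T)) c)"
        using assms(4) T by (simp add: classical_crystal_iso_def KR_crystal_def RC_crystal_def)
      then show ?thesis using count_gt[OF T, of c] that by simp
    qed
    have "?v n = int (?g (n - 1) 0)"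
      using v[of n] sum_last_node[OF g] pattern_zero[OF g] r by (simp add: sum_subtractf)
    then have "iterate_option (nat (?v n)) (rho (Suc n) ?L) (singular_rc (Suc n) r (\<lambda>a. ?g (a - 1))) =
        Some (singular_rc (Suc n) r ?h)"
      using iterate_rho_singular_rc[OF pattern_shift[OF g] r(1,3) promotion_slides[OF r(1,2) assms(5) T]]
      by simp
    then show ?thesis
      unfolding RC_pr_def Let_def L R
      using f_chain_singular_rc[OF g r(1,2), of ?v] v singular_rc_Suc[OF h] psi[OF prS[OF T]] by simp
  qed
  have "\<exists>R'\<in>RC n ?L. RC_pr n ?L R = Some R'" if "R \<in> RC n ?L" for R
  proof -
    have "R \<in> \<Psi> ` ?S" using that bij_betw_imp_surj_on[OF bij] by simp
    then obtain T where T: "T \<in> ?S" "R = \<Psi> T" by blast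
    have "\<Psi> (pr\<^sub>B T) \<in> RC n ?L" using bij_betwE[OF bij] prS[OF T(1)] by blast
    then show ?thesis using main[OF T(1)] T(2) by blast
  qed
  then show ?thesis using main by (simp add: KR_crystal_def)
qed

end
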